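(* Let $\mathfrak D=(Z,X,Y;U,V,W;\Gamma)$ be a $\Pi_+$-admissible BTOA interpolation data set whose BTOA-Pick matrix $\mathbf\Gamma_{\mathfrak D}$ is invertible, and let $\Theta$ and $K_{\Theta,J}$ be the associated matrix function and kernel. Then the reproducing kernel space $\mathcal H(K_{\Theta,J})$ is a Hilbert space if and only if $\mathbf\Gamma_{\mathfrak D}$ is positive definite.
   Context: $\Pi_+=\{z\in\mathbb C:\operatorname{Re}z>0\}$. A $\Pi_+$-admissible BTOA interpolation data set is a septet of matrices $\mathfrak D=(Z,X,Y;U,V,W;\Gamma)$ with $Z\in\mathbb C^{n_Z\times n_Z}$, $X\in\mathbb C^{n_Z\times p}$, $Y\in\mathbb C^{n_Z\times m}$, $W\in\mathbb C^{n_W\times n_W}$, $U\in\mathbb C^{m\times n_W}$, $V\in\mathbb C^{p\times n_W}$, $\Gamma\in\mathbb C^{n_Z\times n_W}$ such that: (1) $\sigma(Z)\cup\sigma(W)\subset\Pi_+$; (2) $(Z,X)$ is controllable and $(U,W)$ is observable; (3) $\Gamma W-Z\Gamma=XV-YU$. The BTOA-Pick matrix is $\mathbf\Gamma_{\mathfrak D}=\begin{bmatrix}\Gamma_L&\Gamma\\ \Gamma^*&\Gamma_R\end{bmatrix}$, where $\Gamma_L,\Gamma_R$ are the unique solutions of $\Gamma_LZ^*+Z\Gamma_L=XX^*-YY^*$ and $\Gamma_RW+W^*\Gamma_R=U^*U-V^*V$. Put $\mathbf A=\begin{bmatrix}-Z^*&0\\0&W\end{bmatrix}$, $\mathbf C=\begin{bmatrix}-X^*&V\\-Y^*&U\end{bmatrix}$,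 $J=\begin{bmatrix}I_p&0\\0&-I_m\end{bmatrix}$ and $\Theta(\lambda)=I_{p+m}-\mathbf C(\lambda I-\mathbf A)^{-1}\mathbf\Gamma_{\mathfrak D}^{-1}\mathbf C^*J$. The kernel is $K_{\Theta,J}(z,\zeta)=\dfrac{J-\Theta(z)J\Theta(\zeta)^*}{z+\overline\zeta}$ for $z,\zeta\in\Pi_+\setminus\sigma(W)$. This Hermitian kernel has finitely many negative squares (there is $\kappa$ such that every block matrix $[K_{\Theta,J}(z_i,z_j)]_{i,j=1}^N$ has at most $\kappa$ negative eigenvalues), and $\mathcal H(K_{\Theta,J})$ denotes its reproducing kernel Pontryagin space: the Pontryagin space of $\mathbb C^{p+m}$-valued functions on $\Pi_+\setminus\sigma(W)$ containing all functions $K_{\Theta,J}(\cdot,\omega)y$ and with the reproducing property $[f,K_{\Theta,J}(\cdot,\omega)y]=\langle f(\omega),y\rangle$. It "is a Hilbert space" when its inner product is positive definite. *)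

theory Defs
  imports
    "HOL-Library.FuncSet"
    "HOL-Analysis.Abstract_Metric_Spaces"
    "Jordan_Normal_Form.Gauss_Jordan_Elimination"
    "Jordan_Normal_Form.Schur_Decomposition"
    "Jordan_Normal_Form.Spectral_Radius"
    "Jordan_Normal_Form.VS_Connect"
begin

section \<open>Matrices\<close>

text \<open>Only meaningful for invertible square matrices.\<close>

definition minv :: "complex mat \<Rightarrow> complex mat" where
  "minv A = the (mat_inverse A)"

definition positive_definite :: "complex mat \<Rightarrow> bool" where
  "positive_definite A \<longleftrightarrow>
     square_mat A \<and> mat_adjoint A = A \<and>
     (\<forall>v \<in> carrier_vec (dim_row A). v \<noteq> 0\<^sub>v (dim_row A) \<longrightarrow> 0 < Re ((A *\<^sub>v v) \<bullet>c v))"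

text \<open>The columns of \<open>X, ZX, \<dots>, Z\<^sup>n\<^sup>-\<^sup>1X\<close> span the state space.\<close>

definition controllable :: "nat \<Rightarrow> complex mat \<Rightarrow> complex mat \<Rightarrow> bool" where
  "controllable n Z X \<longleftrightarrow>
     LinearCombinations.module.span class_ring (module_vec TYPE(complex) n)
       (\<Union>k<n. set (cols (Z ^\<^sub>m k * X))) = carrier_vec n"

text \<open>The intersection of the kernels of \<open>U, UW, \<dots>, UW\<^sup>n\<^sup>-\<^sup>1\<close> is trivial.\<close>

definition observable :: "nat \<Rightarrow> complex mat \<Rightarrow> complex mat \<Rightarrow> bool" where
  "observable n U W \<longleftrightarrow>
     (\<forall>v \<in> carrier_vec n. (\<forall>k<n. (U * W ^\<^sub>m k) *\<^sub>v v = 0\<^sub>v (dim_row U)) \<longrightarrow> v = 0\<^sub>v n)"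

section \<open>Interpolation data sets\<close>

definition right_half_plane :: "complex set" where
  "right_half_plane = {z. 0 < Re z}"

record btoa_data =
  dZ :: "complex mat"
  dX :: "complex mat"
  dY :: "complex mat"
  dU :: "complex mat"
  dV :: "complex mat"
  dW :: "complex mat"
  dGamma :: "complex mat"

definition btoa_admissible :: "nat \<Rightarrow> nat \<Rightarrow> nat \<Rightarrow> nat \<Rightarrow> btoa_data \<Rightarrow> bool" where
  "btoa_admissible nZ nW p m D \<longleftrightarrow>
     dZ D \<in> carrier_mat nZ nZ \<and> dX D \<in> carrier_mat nZ p \<and> dY D \<in> carrier_mat nZ m \<and>
     dW D \<in> carrier_mat nW nW \<and> dU D \<in> carrier_mat m nW \<and> dV D \<in> carrier_mat p nW \<and>
     dGamma D \<in> carrier_mat nZ nW \<and>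
     spectrum (dZ D) \<union> spectrum (dW D) \<subseteq> right_half_plane \<and>
     controllable nZ (dZ D) (dX D) \<and> observable nW (dU D) (dW D) \<and>
     dGamma D * dW D - dZ D * dGamma D = dX D * dV D - dY D * dU D"

text \<open>The following definitions read off the sizes \<open>nZ, nW, p, m\<close> from \<open>Z, W, X, Y\<close>.
  For admissible data the two Lyapunov equations below have exactly one solution, because
  the spectra of \<open>Z\<close> and \<open>W\<close> lie in the open right half plane.\<close>

definition btoa_Gamma_L :: "btoa_data \<Rightarrow> complex mat" where
  "btoa_Gamma_L D =
     (THE G. G \<in> carrier_mat (dim_row (dZ D)) (dim_row (dZ D)) \<and>
        G * mat_adjoint (dZ D) + dZ D * G =
        dX D * mat_adjoint (dX D) - dY D * mat_adjoint (dY D))"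

definition btoa_Gamma_R :: "btoa_data \<Rightarrow> complex mat" where
  "btoa_Gamma_R D =
     (THE G. G \<in> carrier_mat (dim_row (dW D)) (dim_row (dW D)) \<and>
        G * dW D + mat_adjoint (dW D) * G =
        mat_adjoint (dU D) * dU D - mat_adjoint (dV D) * dV D)"

definition btoa_Pick :: "btoa_data \<Rightarrow> complex mat" where
  "btoa_Pick D =
     four_block_mat (btoa_Gamma_L D) (dGamma D) (mat_adjoint (dGamma D)) (btoa_Gamma_R D)"

definition btoa_A :: "btoa_data \<Rightarrow> complex mat" where
  "btoa_A D = (let nZ = dim_row (dZ D); nW = dim_row (dW D) in
     four_block_mat (- mat_adjoint (dZ D)) (0\<^sub>m nZ nW) (0\<^sub>m nW nZ) (dW D))"

definition btoa_C :: "btoa_data \<Rightarrow> complex mat" where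
  "btoa_C D =
     four_block_mat (- mat_adjoint (dX D)) (dV D) (- mat_adjoint (dY D)) (dU D)"

definition btoa_J :: "btoa_data \<Rightarrow> complex mat" where
  "btoa_J D = (let p = dim_col (dX D); m = dim_col (dY D) in
     four_block_mat (1\<^sub>m p) (0\<^sub>m p m) (0\<^sub>m m p) (- 1\<^sub>m m))"

definition btoa_Theta :: "btoa_data \<Rightarrow> complex \<Rightarrow> complex mat" where
  "btoa_Theta D z = (let n = dim_row (dZ D) + dim_row (dW D); q = dim_col (dX D) + dim_col (dY D) in
     1\<^sub>m q - btoa_C D * minv (z \<cdot>\<^sub>m 1\<^sub>m n - btoa_A D) * minv (btoa_Pick D)
             * mat_adjoint (btoa_C D) * btoa_J D)"

definition btoa_domain :: "btoa_data \<Rightarrow> complex set" where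
  "btoa_domain D = right_half_plane - spectrum (dW D)"

definition btoa_kernel :: "btoa_data \<Rightarrow> complex \<Rightarrow> complex \<Rightarrow> complex mat" where
  "btoa_kernel D z w =
     (1 / (z + cnj w)) \<cdot>\<^sub>m
       (btoa_J D - btoa_Theta D z * btoa_J D * mat_adjoint (btoa_Theta D w))"

section \<open>Hilbert spaces and Pontryagin spaces\<close>

text \<open>Forms are linear in the first argument.\<close>

definition hermitian_form ::
    "(complex, 'v, 'b) module_scheme \<Rightarrow> ('v \<Rightarrow> 'v \<Rightarrow> complex) \<Rightarrow> bool" where
  "hermitian_form V ip \<longleftrightarrow>
     (\<forall>x \<in> carrier V. \<forall>y \<in> carrier V. \<forall>z \<in> carrier V. ip (x \<oplus>\<^bsub>V\<^esub> y) z = ip x z + ip y z) \<and>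
     (\<forall>c. \<forall>x \<in> carrier V. \<forall>y \<in> carrier V. ip (c \<odot>\<^bsub>V\<^esub> x) y = c * ip x y) \<and>
     (\<forall>x \<in> carrier V. \<forall>y \<in> carrier V. ip y x = cnj (ip x y))"

definition hilbert_space ::
    "(complex, 'v, 'b) module_scheme \<Rightarrow> ('v \<Rightarrow> 'v \<Rightarrow> complex) \<Rightarrow> bool" where
  "hilbert_space V ip \<longleftrightarrow>
     vectorspace class_ring V \<and> hermitian_form V ip \<and>
     (\<forall>x \<in> carrier V. x \<noteq> \<zero>\<^bsub>V\<^esub> \<longrightarrow> 0 < Re (ip x x)) \<and>
     Metric_space.mcomplete (carrier V) (\<lambda>x y. sqrt (Re (ip (x \<ominus>\<^bsub>V\<^esub> y) (x \<ominus>\<^bsub>V\<^esub> y))))"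

text \<open>
  There is a fundamental decomposition: an orthogonal direct sum of a Hilbert space \<open>P\<close> and
  the antispace of a finite-dimensional Hilbert space \<open>N\<close>.
\<close>

definition pontryagin_space ::
    "(complex, 'v, 'b) module_scheme \<Rightarrow> ('v \<Rightarrow> 'v \<Rightarrow> complex) \<Rightarrow> bool" where
  "pontryagin_space V ip \<longleftrightarrow>
     vectorspace class_ring V \<and> hermitian_form V ip \<and>
     (\<exists>P N. subspace class_ring P V \<and> subspace class_ring N V \<and>
        P \<inter> N = {\<zero>\<^bsub>V\<^esub>} \<and>
        carrier V = {x \<oplus>\<^bsub>V\<^esub> y |x y. x \<in> P \<and> y \<in> N} \<and>
        (\<forall>x \<in> P. \<forall>y \<in> N. ip x y = 0) \<and>
        hilbert_space (V\<lparr>carrier := P\<rparr>) ip \<and>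
        hilbert_space (V\<lparr>carrier := N\<rparr>) (\<lambda>x y. - ip x y) \<and>
        vectorspace.fin_dim class_ring (V\<lparr>carrier := N\<rparr>))"

text \<open>
  A set \<open>H\<close> of functions from \<open>\<Omega>\<close> to \<open>q\<close>-vectors with the pointwise operations. Functions on
  \<open>\<Omega>\<close> are represented by extensional functions, so that equality means equality on \<open>\<Omega>\<close>.
  The ring multiplication and unit of the record play no role.
\<close>

definition fun_space ::
    "nat \<Rightarrow> complex set \<Rightarrow> (complex \<Rightarrow> complex vec) set \<Rightarrow> (complex, complex \<Rightarrow> complex vec) module" where
  "fun_space q \<Omega> H =
     \<lparr>carrier = H, mult = undefined, one = undefined,
      zero = (\<lambda>z\<in>\<Omega>. 0\<^sub>v q), add = (\<lambda>f g. \<lambda>z\<in>\<Omega>. f z + g z),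
      smult = (\<lambda>c f. \<lambda>z\<in>\<Omega>. c \<cdot>\<^sub>v f z)\<rparr>"

definition reproducing_kernel_pontryagin_space ::
    "nat \<Rightarrow> complex set \<Rightarrow> (complex \<Rightarrow> complex \<Rightarrow> complex mat) \<Rightarrow>
     (complex \<Rightarrow> complex vec) set \<Rightarrow>
     ((complex \<Rightarrow> complex vec) \<Rightarrow> (complex \<Rightarrow> complex vec) \<Rightarrow> complex) \<Rightarrow> bool" where
  "reproducing_kernel_pontryagin_space q \<Omega> K H ip \<longleftrightarrow>
     H \<subseteq> \<Omega> \<rightarrow>\<^sub>E carrier_vec q \<and>
     pontryagin_space (fun_space q \<Omega> H) ip \<and>
     (\<forall>\<omega> \<in> \<Omega>. \<forall>y \<in> carrier_vec q.
        (\<lambda>z\<in>\<Omega>. K z \<omega> *\<^sub>v y) \<in> H \<and>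
        (\<forall>f \<in> H. ip f (\<lambda>z\<in>\<Omega>. K z \<omega> *\<^sub>v y) = f \<omega> \<bullet>c y))"

end

theory Submission
  imports Defs
begin

text \<open>
  Write \<open>P\<close> for the Pick matrix and \<open>R(z) = (z - A)\<^sup>-\<^sup>1\<close>. The two Lyapunov equations and the coupling
  equation combine to \<open>P A + A\<^sup>* P = - C\<^sup>* J C\<close>, which gives
  \<open>K(z, w) = C R(z) P\<^sup>-\<^sup>1 R(w)\<^sup>* C\<^sup>*\<close>. Controllability and observability, together with the disjointness
  of the spectra of \<open>- Z\<^sup>*\<close> and \<open>W\<close>, show that no eigenvector of \<open>A\<close> is in the kernel of \<open>C\<close>, so
  the vectors \<open>R(w)\<^sup>* C\<^sup>* y\<close> span the whole space. Hence the reproducing kernel space consists of the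
  functions \<open>C R(\<cdot>) P\<^sup>-\<^sup>1 v\<close>, and its inner product is the form of \<open>P\<^sup>-\<^sup>1\<close>.
\<close>

subsection \<open>Matrices and adjoints\<close>

text \<open>The space \<open>H\<close> is not constructed. It is any Pontryagin space with the
  reproducing property, and its form is controlled only on \<open>H\<close>, so the
  finite-dimensional model must be forced upon it. The kernel functions lie in \<open>H\<close>, and
  their sums give every function of the model. An arbitrary \<open>f\<close> is matched with one of
  these through the functional \<open>ip f\<close>, and the reproducing property turns equal inner
  products into equal values. Positivity passes between the forms of \<open>P\<close> and of its
  inverse by the substitution u = P v. Completeness needs no estimate: a positive definite
  Pontryagin space equals the Hilbert summand of its fundamental decomposition.

  The obstacle is spanning. The hypotheses restrict eigenvectors of \<open>A\<close>, whereas the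
  span involves resolvents at points off the spectrum. The bridge is a calculus of polynomials and
  products of resolvents, given by lists of roots and poles. The polynomial half of it also solves
  Sylvester equations, on which the two diagonal blocks of the Pick matrix rest.\<close>

lemma mat_adjoint_index [simp]:
  "i < dim_col A \<Longrightarrow> j < dim_row A \<Longrightarrow> mat_adjoint A $$ (i, j) = conjugate (A $$ (j, i))"
  "dim_row (mat_adjoint A) = dim_col A" "dim_col (mat_adjoint A) = dim_row A"
  by (auto simp: mat_adjoint_def mat_of_rows_def)

lemma mat_adjoint_carrier [simp]: "A \<in> carrier_mat m n \<Longrightarrow> mat_adjoint A \<in> carrier_mat n m"
  by (auto intro!: carrier_matI)

lemma mat_adjoint_adjoint [simp]: "mat_adjoint (mat_adjoint A) = A"
  by (rule eq_matI) auto

lemma mat_adjoint_one [simp]: "mat_adjoint (1\<^sub>m n :: complex mat) = 1\<^sub>m n"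
  by (rule eq_matI) auto

lemma mat_adjoint_zero [simp]: "mat_adjoint (0\<^sub>m m n) = 0\<^sub>m n m"
  by (rule eq_matI) auto

lemma mat_adjoint_add:
  "A \<in> carrier_mat m n \<Longrightarrow> B \<in> carrier_mat m n \<Longrightarrow>
   mat_adjoint (A + B) = mat_adjoint A + mat_adjoint B"
  by (rule eq_matI) (auto simp: conjugate_dist_add)

lemma mat_adjoint_minus:
  "A \<in> carrier_mat m n \<Longrightarrow> B \<in> carrier_mat m n \<Longrightarrow>
   mat_adjoint (A - B :: complex mat) = mat_adjoint A - mat_adjoint B"
  by (rule eq_matI) auto

lemma mat_adjoint_uminus: "mat_adjoint (- A :: complex mat) = - mat_adjoint A"
  by (rule eq_matI) auto

lemma mat_adjoint_smult: "mat_adjoint (c \<cdot>\<^sub>m A :: complex mat) = cnj c \<cdot>\<^sub>m mat_adjoint A"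
  by (rule eq_matI) auto

lemma mat_adjoint_mult:
  assumes "A \<in> carrier_mat m n" "B \<in> carrier_mat n k"
  shows "mat_adjoint (A * B :: complex mat) = mat_adjoint B * mat_adjoint A"
  using assms by (intro eq_matI) (auto simp: scalar_prod_def mult.commute)

lemma mat_adjoint_four_block:
  assumes "A \<in> carrier_mat r1 c1" "B \<in> carrier_mat r1 c2"
    "C \<in> carrier_mat r2 c1" "D \<in> carrier_mat r2 c2"
  shows "mat_adjoint (four_block_mat A B C D) =
    four_block_mat (mat_adjoint A) (mat_adjoint C) (mat_adjoint B) (mat_adjoint D)"
  using assms by (intro eq_matI) auto

lemma cscalar_mat_adjoint:
  assumes "A \<in> carrier_mat m n" "v \<in> carrier_vec n" "w \<in> carrier_vec m"
  shows "(A *\<^sub>v v) \<bullet>c (w :: complex vec) = v \<bullet>c (mat_adjoint A *\<^sub>v w)"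
proof -
  have "(A *\<^sub>v v) \<bullet>c w = (\<Sum>i<m. \<Sum>j<n. A $$ (i, j) * v $ j * cnj (w $ i))"
    using assms by (auto simp: scalar_prod_def sum_distrib_right atLeast0LessThan intro!: sum.cong)
  also have "\<dots> = (\<Sum>j<n. \<Sum>i<m. A $$ (i, j) * v $ j * cnj (w $ i))"
    by (rule sum.swap)
  also have "\<dots> = v \<bullet>c (mat_adjoint A *\<^sub>v w)"
    using assms
    by (auto simp: scalar_prod_def sum_distrib_left cnj_sum atLeast0LessThan mult_ac intro!: sum.cong)
  finally show ?thesis .
qed

lemma cscalar_swap:
  assumes "v \<in> carrier_vec n" "w \<in> carrier_vec n"
  shows "v \<bullet>c (w :: complex vec) = cnj (w \<bullet>c v)"
  using assms by (auto simp: scalar_prod_def cnj_sum mult.commute intro!: sum.cong)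

lemma cscalar_self:
  assumes "v \<in> carrier_vec n"
  shows "Im (v \<bullet>c v) = 0" "0 \<le> Re (v \<bullet>c v)" "Re (v \<bullet>c v) = 0 \<Longrightarrow> v = 0\<^sub>v n"
proof -
  have "0 \<le> v \<bullet>c v" by (rule conjugate_square_ge_0_vec)
  then show "Im (v \<bullet>c v) = 0" "0 \<le> Re (v \<bullet>c v)" by (auto simp: less_eq_complex_def)
  then show "v = 0\<^sub>v n" if "Re (v \<bullet>c v) = 0"
    using conjugate_square_eq_0_vec[OF assms] that by (auto simp: complex_eq_iff)
qed

lemma cscalar_eqI:
  assumes "v \<in> carrier_vec n" "w \<in> carrier_vec n"
    and "\<And>y. y \<in> carrier_vec n \<Longrightarrow> v \<bullet>c y = w \<bullet>c (y :: complex vec)"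
  shows "v = w"
proof -
  have "v - w = 0\<^sub>v n"
    using assms(3)[of "v - w"] assms(1,2)
    by (intro cscalar_self(3)) (auto simp: minus_scalar_prod_distrib[of _ n])
  then have "(v - w) $ i = 0" if "i < n" for i using that by simp
  then show ?thesis using assms(1,2) by (intro eq_vecI) auto
qed

text \<open>For a square matrix a trivial kernel means a nonzero determinant, so
  \<open>mat_inverse\<close> returns \<open>Some\<close> and \<open>the\<close> is harmless. Later
  inverses are all obtained by proving injectivity.\<close>

lemma minv:
  assumes "M \<in> carrier_mat n n" "\<And>v. v \<in> carrier_vec n \<Longrightarrow> M *\<^sub>v v = 0\<^sub>v n \<Longrightarrow> v = 0\<^sub>v n"
  shows "minv M \<in> carrier_mat n n" "M * minv M = 1\<^sub>m n" "minv M * M = 1\<^sub>m n"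
proof -
  have "det M \<noteq> 0"
    using assms(2) unfolding det_0_iff_vec_prod_zero[OF assms(1)] by blast
  then have "M \<in> Units (ring_mat TYPE(complex) n ())"
    by (rule det_non_zero_imp_unit[OF assms(1)])
  then obtain B where "mat_inverse M = Some B"
    using mat_inverse(1)[OF assms(1), where b = "()"] by (cases "mat_inverse M") auto
  with mat_inverse(2)[OF assms(1)]
  show "minv M \<in> carrier_mat n n" "M * minv M = 1\<^sub>m n" "minv M * M = 1\<^sub>m n"
    by (auto simp: minv_def)
qed

lemma left_inverse_inj:
  assumes "N \<in> carrier_mat n k" "M \<in> carrier_mat k n" "N * M = 1\<^sub>m n"
    and "v \<in> carrier_vec n" "M *\<^sub>v v = 0\<^sub>v k"
  shows "v = (0\<^sub>v n :: complex vec)"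
proof -
  have "v = (N * M) *\<^sub>v v" using assms by simp
  also have "\<dots> = N *\<^sub>v (M *\<^sub>v v)" using assms by (intro assoc_mult_mat_vec)
  also have "\<dots> = 0\<^sub>v n" unfolding assms(5) using assms(1) by (auto intro!: eq_vecI)
  finally show ?thesis .
qed

lemma minv_invertible:
  assumes "M \<in> carrier_mat n n" "invertible_mat M"
  shows "minv M \<in> carrier_mat n n" "M * minv M = 1\<^sub>m n" "minv M * M = 1\<^sub>m n"
proof -
  obtain B where B: "inverts_mat M B" "inverts_mat B M"
    using assms(2) by (auto simp: invertible_mat_def)
  \<comment> \<open>\<open>invertible_mat\<close> does not fix the size of \<open>B\<close>; it is
    recovered by comparing the column counts in the two inverse equations.\<close>
  have "dim_col (M * B) = dim_row M" "dim_col (B * M) = dim_row B"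
    using B unfolding inverts_mat_def by simp_all
  then have Bc: "B \<in> carrier_mat n n" using assms(1) by (intro carrier_matI) auto
  then have "B * M = 1\<^sub>m n" using B(2) by (simp add: inverts_mat_def)
  then have "v = 0\<^sub>v n" if "v \<in> carrier_vec n" "M *\<^sub>v v = 0\<^sub>v n" for v
    using left_inverse_inj[OF Bc assms(1)] that by blast
  from minv[OF assms(1) this]
  show "minv M \<in> carrier_mat n n" "M * minv M = 1\<^sub>m n" "minv M * M = 1\<^sub>m n" by auto
qed

text \<open>The adjoint of the inverse is a left inverse of the Hermitian \<open>M\<close>, and a
  left inverse equals a right inverse.\<close>

lemma minv_hermitian:
  assumes "M \<in> carrier_mat n n" "invertible_mat M" "mat_adjoint M = M"
  shows "mat_adjoint (minv M) = minv M"
proof -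
  note M = minv_invertible[OF assms(1,2)]
  let ?N = "mat_adjoint (minv M)"
  have N: "?N \<in> carrier_mat n n" using M by simp
  have "?N * M = mat_adjoint (M * minv M)"
    using mat_adjoint_mult[OF assms(1) M(1)] assms(3) by simp
  then have NM: "?N * M = 1\<^sub>m n" using M by simp
  have "?N = ?N * (M * minv M)" using M N by simp
  also have "\<dots> = (?N * M) * minv M" using M N assms(1) by (intro assoc_mult_mat[symmetric])
  also have "\<dots> = minv M" unfolding NM using M by simp
  finally show ?thesis .
qed

section \<open>Polynomials in a matrix, given by their roots\<close>

abbreviation mshift :: "complex mat \<Rightarrow> complex \<Rightarrow> complex mat" where
  "mshift A e \<equiv> A - e \<cdot>\<^sub>m 1\<^sub>m (dim_row A)"

lemma mshift_mult_vec:
  assumes "A \<in> carrier_mat n n" "v \<in> carrier_vec n"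
  shows "mshift A e *\<^sub>v v = A *\<^sub>v v - e \<cdot>\<^sub>v v"
  using assms by (intro eq_vecI) (auto simp: minus_mult_distrib_mat_vec)

lemma spectrum_iff:
  assumes "A \<in> carrier_mat n n"
  shows "e \<in> spectrum A \<longleftrightarrow> (\<exists>v \<in> carrier_vec n. v \<noteq> 0\<^sub>v n \<and> A *\<^sub>v v = e \<cdot>\<^sub>v v)"
  using assms by (auto simp: spectrum_def eigenvalue_def eigenvector_def)

text \<open>The monic polynomial with root list \<open>es\<close>, evaluated at \<open>A\<close>.
  Keeping the linear factors in a list gives access to partial products and makes each argument an
  induction on factors.\<close>

fun mprod :: "complex mat \<Rightarrow> complex list \<Rightarrow> complex mat" where
  "mprod A [] = 1\<^sub>m (dim_row A)"
| "mprod A (e # es) = mshift A e * mprod A es"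

lemma mprod_carrier [simp]: "A \<in> carrier_mat n n \<Longrightarrow> mprod A es \<in> carrier_mat n n"
  by (induction es) auto

text \<open>Cayley-Hamilton through a Schur basis. There \<open>A\<close> is triangular with
  diagonal \<open>es\<close>, so shifting by the k-th diagonal entry maps the span of the first k
  basis vectors into the span of the first k - 1, and the whole product reaches zero.\<close>

lemma annihilating_product:
  assumes A: "A \<in> carrier_mat n n"
  obtains es where "set es \<subseteq> spectrum A" "mprod A es = 0\<^sub>m n n"
proof -
  obtain es where es: "char_poly A = (\<Prod>e\<leftarrow>es. [:- e, 1:])" 
    using char_poly_factorized[OF A] by blast
  obtain B P Q where s: "schur_decomposition A es = (B, P, Q)"
    by (metis prod_cases3)
  have sim: "similar_mat_wit A B P Q" and ut: "upper_triangular B" and dg: "diag_mat B = es"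
    using schur_decomposition[OF A es s] by auto
  note S = similar_mat_witD2[OF A sim]
  note SC = S(5-7)
  have len: "length es = n" using dg SC by (auto simp: diag_mat_def)
  have QA: "Q * A = B * Q"
  proof -
    have "Q * A = Q * (P * B * Q)" by (subst S(3)) simp
    also have "\<dots> = (Q * P) * B * Q" using SC by (simp add: assoc_mult_mat[of _ n n _ n _ n])
    also have "\<dots> = B * Q" unfolding S(2) using SC by simp
    finally show ?thesis .
  qed
  \<comment> \<open>\<open>Q\<close> takes coordinates in the Schur basis; the last premise puts
    \<open>v\<close> in the span of the first \<open>k\<close> basis vectors.\<close>
  have main: "mprod A (take k es) *\<^sub>v v = 0\<^sub>v n"
    if "k \<le> n" "v \<in> carrier_vec n" "\<And>i. k \<le> i \<Longrightarrow> i < n \<Longrightarrow> (Q *\<^sub>v v) $ i = 0" for k v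
    using that
  proof (induction k arbitrary: v)
    case 0
    have "Q *\<^sub>v v = 0\<^sub>v n" using 0 SC by (intro eq_vecI) auto
    then have "v = 0\<^sub>v n" by (rule left_inverse_inj[OF S(6,7,1) 0(2)])
    then show ?case using A by auto
  next
    case (Suc k)
    let ?e = "es ! k"
    let ?w = "mshift A ?e *\<^sub>v v"
    \<comment> \<open>\<open>mprod\<close> peels factors off the front, but this induction removes
      the last factor, the one that acts first.\<close>
    have comm: "mprod A (xs @ [e]) = mprod A xs * mshift A e" for xs e
    proof (induction xs)
      case Nil
      then show ?case using A by simp
    next
      case (Cons a xs)
      have "mshift A a * (mprod A xs * mshift A e) = mshift A a * mprod A xs * mshift A e"
        using A by (intro assoc_mult_mat[symmetric, of _ n n _ n _ n]) (auto simp: minus_carrier_mat)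
      then show ?case using Cons by simp
    qed
    have w: "?w \<in> carrier_vec n" using A by (auto intro!: carrier_vecI)
    have Qw: "Q *\<^sub>v ?w = B *\<^sub>v (Q *\<^sub>v v) - ?e \<cdot>\<^sub>v (Q *\<^sub>v v)"
    proof -
      have "Q *\<^sub>v ?w = Q *\<^sub>v (A *\<^sub>v v) - Q *\<^sub>v (?e \<cdot>\<^sub>v v)"
        unfolding mshift_mult_vec[OF A Suc.prems(2)]
        using A SC Suc.prems(2) by (intro mult_minus_distrib_mat_vec) auto
      also have "Q *\<^sub>v (A *\<^sub>v v) = B *\<^sub>v (Q *\<^sub>v v)"
        using A SC Suc.prems QA by (metis assoc_mult_mat_vec)
      also have "Q *\<^sub>v (?e \<cdot>\<^sub>v v) = ?e \<cdot>\<^sub>v (Q *\<^sub>v v)"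
        using SC Suc.prems by (simp add: mult_mat_vec)
      finally show ?thesis .
    qed
    \<comment> \<open>In row \<open>i\<close> the columns \<open>j < k\<close> vanish by
      triangularity and the coordinates \<open>j > k\<close> by assumption, so only column
      \<open>k\<close> is left. For \<open>i = k\<close> it carries the diagonal entry
      \<open>?e\<close>; for \<open>i > k\<close> both sides vanish.\<close>
    have "(Q *\<^sub>v ?w) $ i = 0" if i: "k \<le> i" "i < n" for i
    proof -
      have "(B *\<^sub>v (Q *\<^sub>v v)) $ i = (\<Sum>j<n. B $$ (i, j) * (Q *\<^sub>v v) $ j)"
        using SC i Suc.prems by (auto simp: scalar_prod_def atLeast0LessThan intro!: sum.cong)
      also have "\<dots> = (\<Sum>j<n. if j = k then B $$ (i, j) * (Q *\<^sub>v v) $ j else 0)"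
      proof (rule sum.cong[OF refl])
        fix j assume "j \<in> {..<n}"
        then show "B $$ (i, j) * (Q *\<^sub>v v) $ j = (if j = k then B $$ (i, j) * (Q *\<^sub>v v) $ j else 0)"
          using Suc.prems(3)[of j] upper_triangularD[OF ut, of j i] i SC
          by (cases "j < k") (auto simp: less_eq_Suc_le[symmetric] simp del: index_mult_mat_vec)
      qed
      also have "\<dots> = B $$ (i, k) * (Q *\<^sub>v v) $ k" using i by simp
      also have "\<dots> = ?e * (Q *\<^sub>v v) $ i"
      proof (cases "i = k")
        case True
        then show ?thesis using dg[symmetric] SC i by (simp add: diag_mat_def)
      next
        case False
        then show ?thesis
          using Suc.prems(3)[of i] upper_triangularD[OF ut, of k i] i SC
          by (auto simp del: index_mult_mat_vec)
      qed
      finally show ?thesis unfolding Qw using SC i by (simp del: index_mult_mat_vec)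
    qed
    then have "mprod A (take k es) *\<^sub>v ?w = 0\<^sub>v n"
      using Suc w by auto
    moreover have "mprod A (take k es) *\<^sub>v ?w = (mprod A (take k es) * mshift A ?e) *\<^sub>v v"
      using A Suc.prems by (intro assoc_mult_mat_vec[symmetric, of _ n n _ n]) auto
    ultimately show ?case
      using comm len Suc.prems by (simp add: take_Suc_conv_app_nth)
  qed
  have "mprod A es = 0\<^sub>m n n"
  proof (rule eq_matI)
    fix i j assume ij: "i < dim_row (0\<^sub>m n n)" "j < dim_col (0\<^sub>m n n)"
    have "mprod A es *\<^sub>v unit_vec n j = 0\<^sub>v n"
      using main[of n "unit_vec n j"] len by simp
    then have "(mprod A es *\<^sub>v unit_vec n j) $ i = 0" using ij by simp
    then show "mprod A es $$ (i, j) = 0\<^sub>m n n $$ (i, j)"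
      using ij mprod_carrier[OF A, of es] by (auto simp: scalar_prod_right_unit)
  qed (use mprod_carrier[OF A, of es] in auto)
  moreover have "set es \<subseteq> spectrum A"
  proof
    fix e assume "e \<in> set es"
    then have "poly (char_poly A) e = 0"
      unfolding es by (auto simp: poly_prod_list prod_list_zero_iff image_iff)
    then show "e \<in> spectrum A" unfolding spectrum_root_char_poly[OF A] by auto
  qed
  ultimately show thesis using that by blast
qed

subsection \<open>Sylvester equations\<close>

lemma mshift_carrier [simp]: "A \<in> carrier_mat n n \<Longrightarrow> A - e \<cdot>\<^sub>m 1\<^sub>m n \<in> carrier_mat n n"
  by (auto simp: minus_carrier_mat)

lemma mshift_mult_mat:
  assumes "A \<in> carrier_mat n n" "M \<in> carrier_mat n k"
  shows "mshift A e * M = A * M - e \<cdot>\<^sub>m M"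
  using assms by (auto simp: minus_mult_distrib_mat[of _ n n])

lemma mat_mult_mshift:
  assumes "A \<in> carrier_mat n n" "M \<in> carrier_mat k n"
  shows "M * mshift A e = M * A - e \<cdot>\<^sub>m M"
  using assms
  by (simp add: mult_minus_distrib_mat[of _ k n _ n] mult_smult_distrib[of M k n "1\<^sub>m n" n e])

lemma mprod_commute:
  assumes "A \<in> carrier_mat n n"
  shows "mprod A es * A = A * mprod A es"
proof (induction es)
  case (Cons e es)
  let ?P = "mprod A es"
  have P: "?P \<in> carrier_mat n n" using assms by simp
  have "mprod A (e # es) * A = mshift A e * (?P * A)"
    using assms P by (simp add: assoc_mult_mat[of _ n n _ n _ n])
  also have "\<dots> = A * (A * ?P) - e \<cdot>\<^sub>m (A * ?P)"
    unfolding Cons by (rule mshift_mult_mat) (use assms P in auto)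
  also have "\<dots> = A * (A * ?P - e \<cdot>\<^sub>m ?P)"
    using assms P
    by (simp add: mult_minus_distrib_mat[of A n n _ n] mult_smult_distrib[of A n n ?P n])
  also have "\<dots> = A * mprod A (e # es)"
    using mshift_mult_mat[OF assms P] by simp
  finally show ?case .
qed (use assms in simp)

lemma mshift_injective:
  assumes "A \<in> carrier_mat n n" "e \<notin> spectrum A" "v \<in> carrier_vec n" "mshift A e *\<^sub>v v = 0\<^sub>v n"
  shows "v = 0\<^sub>v n"
proof (rule ccontr)
  assume nz: "v \<noteq> 0\<^sub>v n"
  have "(A *\<^sub>v v) $ i = (e \<cdot>\<^sub>v v) $ i" if "i < n" for i
    using arg_cong[OF assms(4)[unfolded mshift_mult_vec[OF assms(1,3)]], of "\<lambda>v. v $ i"] that assms(1,3)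
    by (auto simp del: index_mult_mat_vec)
  then have "A *\<^sub>v v = e \<cdot>\<^sub>v v" using assms(1,3) by (intro eq_vecI) auto
  with nz assms show False by (auto simp: spectrum_iff)
qed

lemma mprod_injective:
  assumes "A \<in> carrier_mat n n" "set es \<inter> spectrum A = {}" "v \<in> carrier_vec n"
    "mprod A es *\<^sub>v v = 0\<^sub>v n"
  shows "v = 0\<^sub>v n"
  using assms(2-)
proof (induction es)
  case (Cons e es)
  have "mshift A e *\<^sub>v (mprod A es *\<^sub>v v) = 0\<^sub>v n"
    using Cons.prems(3) assoc_mult_mat_vec[of "mshift A e" n n "mprod A es" n v] assms(1) Cons.prems by simp
  moreover have "mprod A es *\<^sub>v v \<in> carrier_vec n"
    using mprod_carrier[OF assms(1)] Cons.prems by (intro mult_mat_vec_carrier)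
  ultimately have "mprod A es *\<^sub>v v = 0\<^sub>v n"
    using mshift_injective[OF assms(1)] Cons.prems by auto
  with Cons show ?case by auto
qed (use assms(1) in auto)

text \<open>Invertibility passes to adjoints: an inverse of \<open>A\<close> shifted by
  \<open>cnj e\<close> would yield a left inverse of the adjoint of \<open>A\<close> shifted by
  \<open>e\<close>, leaving no eigenvector there.\<close>

lemma spectrum_adjoint:
  assumes "A \<in> carrier_mat n n" "e \<in> spectrum (mat_adjoint A)"
  shows "cnj e \<in> spectrum A"
proof (rule ccontr)
  assume "cnj e \<notin> spectrum A"
  let ?M = "mshift A (cnj e)"
  have M: "?M \<in> carrier_mat n n" using assms by simp
  note N = minv[OF M mshift_injective[OF assms(1) \<open>cnj e \<notin> _\<close>]]
  have "mat_adjoint (minv ?M) * mat_adjoint ?M = 1\<^sub>m n"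
    using mat_adjoint_mult[OF M N(1)] N(2) by simp
  moreover have "mat_adjoint ?M = mshift (mat_adjoint A) e"
    using assms(1) by (subst mat_adjoint_minus[of _ n n]) (auto simp: mat_adjoint_smult)
  ultimately have *: "mat_adjoint (minv ?M) * mshift (mat_adjoint A) e = 1\<^sub>m n" by simp
  obtain v where v: "v \<in> carrier_vec n" "v \<noteq> 0\<^sub>v n" "mat_adjoint A *\<^sub>v v = e \<cdot>\<^sub>v v"
    using assms(2) by (auto simp: spectrum_iff[OF mat_adjoint_carrier[OF assms(1)]])
  have "mshift (mat_adjoint A) e *\<^sub>v v = 0\<^sub>v n"
    unfolding mshift_mult_vec[OF mat_adjoint_carrier[OF assms(1)] v(1)] v(3) using v(1) by auto
  from left_inverse_inj[OF _ _ * v(1) this] have "v = 0\<^sub>v n" using N assms(1) by simp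
  with v(2) show False by simp
qed

text \<open>For the block matrix \<open>M = [[T, Q], [0, B]]\<close>, the corner entry of \<open>M p(M) = p(M) M\<close> with
  \<open>p = \<Prod> (x - e)\<close> and \<open>S\<close> the corner entry of \<open>p(M)\<close>.\<close>

lemma mprod_intertwine:
  assumes T: "T \<in> carrier_mat n n" and B: "(B :: complex mat) \<in> carrier_mat k k" and Q: "Q \<in> carrier_mat n k"
  shows "\<exists>S \<in> carrier_mat n k. T * S = S * B + (mprod T es * Q - Q * mprod B es)"
proof (induction es)
  case Nil
  show ?case using assms by (intro bexI[of _ "0\<^sub>m n k"]) auto
next
  case (Cons e es)
  define P p where "P = mprod T es" and "p = mprod B es"
  have P: "P \<in> carrier_mat n n" and p: "p \<in> carrier_mat k k"
    using T B by (simp_all add: P_def p_def)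
  obtain S where S: "S \<in> carrier_mat n k" and IH: "T * S = S * B + (P * Q - Q * p)"
    using Cons unfolding P_def p_def by blast
  \<comment> \<open>The corner entry of \<open>(M - e) p(M)\<close>: the block row
    \<open>(T - e, Q)\<close> against the block column of \<open>S\<close> and
    \<open>p\<close>.\<close>
  define S' where "S' = (T * S - e \<cdot>\<^sub>m S) + Q * p"
  note c = T B Q P p S
  have S': "S' \<in> carrier_mat n k" using c by (simp add: S'_def)
  have h1: "T * S' = (T * (T * S) - e \<cdot>\<^sub>m (T * S)) + T * (Q * p)"
  proof -
    have "T * S' = T * (T * S - e \<cdot>\<^sub>m S) + T * (Q * p)"
      unfolding S'_def using c by (intro mult_add_distrib_mat) auto
    also have "T * (T * S - e \<cdot>\<^sub>m S) = T * (T * S) - T * (e \<cdot>\<^sub>m S)"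
      using c by (intro mult_minus_distrib_mat) auto
    also have "T * (e \<cdot>\<^sub>m S) = e \<cdot>\<^sub>m (T * S)"
      using c by (intro mult_smult_distrib) auto
    finally show ?thesis .
  qed
  have h2: "S' * B = (T * (S * B) - e \<cdot>\<^sub>m (S * B)) + Q * (B * p)"
  proof -
    have "S' * B = (T * S - e \<cdot>\<^sub>m S) * B + (Q * p) * B"
      unfolding S'_def using c by (intro add_mult_distrib_mat) auto
    also have "(T * S - e \<cdot>\<^sub>m S) * B = (T * S) * B - (e \<cdot>\<^sub>m S) * B"
      using c by (intro minus_mult_distrib_mat) auto
    also have "(e \<cdot>\<^sub>m S) * B = e \<cdot>\<^sub>m (S * B)"
      using c by (intro mult_smult_assoc_mat) auto
    also have "(Q * p) * B = Q * (p * B)" using c by (intro assoc_mult_mat) auto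
    also have "p * B = B * p" unfolding p_def by (rule mprod_commute[OF B])
    also have "(T * S) * B = T * (S * B)" using c by (intro assoc_mult_mat) auto
    finally show ?thesis .
  qed
  have h4: "T * (T * S) = T * (S * B) + (T * (P * Q) - T * (Q * p))"
  proof -
    have "T * (T * S) = T * (S * B) + T * (P * Q - Q * p)"
      unfolding IH using c by (intro mult_add_distrib_mat) auto
    also have "T * (P * Q - Q * p) = T * (P * Q) - T * (Q * p)"
      using c by (intro mult_minus_distrib_mat) auto
    finally show ?thesis .
  qed
  have h5: "mprod T (e # es) * Q = T * (P * Q) - e \<cdot>\<^sub>m (P * Q)"
  proof -
    have "mprod T (e # es) * Q = mshift T e * (P * Q)"
      unfolding P_def mprod.simps using c by (intro assoc_mult_mat[of _ n n _ n]) auto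
    also have "\<dots> = T * (P * Q) - e \<cdot>\<^sub>m (P * Q)"
      using c by (intro mshift_mult_mat) auto
    finally show ?thesis .
  qed
  have h6: "Q * mprod B (e # es) = Q * (B * p) - e \<cdot>\<^sub>m (Q * p)"
  proof -
    have "mprod B (e # es) = B * p - e \<cdot>\<^sub>m p"
      unfolding p_def mprod.simps using p[unfolded p_def] by (intro mshift_mult_mat[OF B])
    then have "Q * mprod B (e # es) = Q * (B * p) - Q * (e \<cdot>\<^sub>m p)"
      using c by (simp add: mult_minus_distrib_mat[of Q n k _ k])
    also have "Q * (e \<cdot>\<^sub>m p) = e \<cdot>\<^sub>m (Q * p)"
      using c by (intro mult_smult_distrib) auto
    finally show ?thesis .
  qed
  \<comment> \<open>With \<open>index_mult_mat(1)\<close> deleted, entries of products stay atoms,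
    so the identity is linear in each entry.\<close>
  have "T * S' = S' * B + (mprod T (e # es) * Q - Q * mprod B (e # es))"
    unfolding h1 h2 h4 h5 h6 unfolding IH using c
    by (intro eq_matI) (auto simp del: index_mult_mat(1) simp: algebra_simps)
  with S' show ?case by blast
qed

text \<open>Take a polynomial that annihilates \<open>B\<close> and has its roots in the spectrum of
  \<open>B\<close>. Its value \<open>P\<close> at \<open>T\<close> is invertible because the spectra
  are disjoint, and dividing the intertwining relation by \<open>P\<close> solves the equation. A
  solution of the homogeneous equation intertwines the values of the polynomial at \<open>T\<close>
  and at \<open>B\<close>; the latter is zero, so that solution vanishes.\<close>

lemma sylvester_unique:
  assumes T: "T \<in> carrier_mat n n" and B: "(B :: complex mat) \<in> carrier_mat k k" and Q: "Q \<in> carrier_mat n k"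
    and disj: "spectrum T \<inter> spectrum B = {}"
  shows "\<exists>!G. G \<in> carrier_mat n k \<and> T * G = G * B + Q"
proof -
  obtain es where es: "set es \<subseteq> spectrum B" "mprod B es = 0\<^sub>m k k"
    using annihilating_product[OF B] .
  define P where "P = mprod T es"
  have P: "P \<in> carrier_mat n n" using T by (simp add: P_def)
  have inj: "v = 0\<^sub>v n" if "v \<in> carrier_vec n" "P *\<^sub>v v = 0\<^sub>v n" for v
    using mprod_injective[OF T _ that(1)] es(1) disj that(2) unfolding P_def by blast
  define R where "R = minv P"
  note R = minv[OF P inj, folded R_def]
  have TR: "T * R = R * T"
  proof -
    have "T * R = 1\<^sub>m n * (T * R)" using R(1) T by simp
    also have "\<dots> = (R * P) * (T * R)" by (simp only: R(3))
    also have "\<dots> = R * ((P * T) * R)" using R(1) T P by (simp add: assoc_mult_mat[of _ n n _ n _ n])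
    also have "P * T = T * P" unfolding P_def by (rule mprod_commute[OF T])
    also have "R * ((T * P) * R) = R * T * (P * R)"
      using R(1) T P by (simp add: assoc_mult_mat[of _ n n _ n _ n])
    also have "\<dots> = R * T * 1\<^sub>m n" by (simp only: R(2))
    also have "\<dots> = R * T" using R(1) T by simp
    finally show ?thesis .
  qed
  obtain S where S: "S \<in> carrier_mat n k" "T * S = S * B + (P * Q - Q * 0\<^sub>m k k)"
    using mprod_intertwine[OF T B Q, of es] es(2) P_def by auto
  have S2: "T * S = S * B + P * Q" unfolding S(2) using Q P S(1) B by (intro eq_matI) (auto simp del: index_mult_mat(1))
  have RP: "R * (P * X) = X" if X: "X \<in> carrier_mat n k" for X
  proof -
    have "R * (P * X) = R * P * X" using R(1) P X by (intro assoc_mult_mat[symmetric])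
    also have "\<dots> = 1\<^sub>m n * X" by (simp only: R(3))
    finally show ?thesis using X by simp
  qed
  show ?thesis
  proof (rule ex1I[of _ "R * S"], intro conjI)
    show "R * S \<in> carrier_mat n k" using R(1) S(1) by simp
    have "T * (R * S) = T * R * S"
      using T R(1) S(1) by (intro assoc_mult_mat[symmetric])
    also have "\<dots> = R * (T * S)"
      unfolding TR using T R(1) S(1) by (intro assoc_mult_mat)
    also have "\<dots> = R * (S * B) + R * (P * Q)"
      unfolding S2 using R(1) S(1) B P Q by (intro mult_add_distrib_mat) auto
    also have "R * (P * Q) = Q" by (rule RP[OF Q])
    also have "R * (S * B) = R * S * B" using R(1) S(1) B by simp
    finally show "T * (R * S) = R * S * B + Q" .
  next
    fix G assume "G \<in> carrier_mat n k \<and> T * G = G * B + Q"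
    then have G: "G \<in> carrier_mat n k" "T * G = G * B + Q" by auto
    have "P * G = S"
    proof -
      \<comment> \<open>Both \<open>P * G\<close> and \<open>S\<close> solve the equation with
        \<open>P * Q\<close> in place of \<open>Q\<close>, so \<open>E\<close> solves the
        homogeneous one.\<close>
      define E where "E = P * G - S"
      have E: "E \<in> carrier_mat n k" using P G(1) S(1) by (simp add: E_def minus_carrier_mat)
      have "P * (T * G) = T * (P * G)"
        using mprod_commute[OF T, of es] assoc_mult_mat[OF P T G(1)] assoc_mult_mat[OF T P G(1)]
        unfolding P_def[symmetric] by simp
      then have TPG: "T * (P * G) = P * G * B + P * Q"
        using mult_add_distrib_mat[OF P mult_carrier_mat[OF G(1) B] Q] assoc_mult_mat[OF P G(1) B]
        unfolding G(2) by simp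
      have "T * E = T * (P * G) - T * S" 
        unfolding E_def using T P G(1) S(1) by (intro mult_minus_distrib_mat) auto
      moreover have "E * B = P * G * B - S * B"
        unfolding E_def using B P G(1) S(1) by (intro minus_mult_distrib_mat) auto
      ultimately have TE: "T * E = E * B"
        unfolding TPG S2 using T P G(1) S(1) B Q by (intro eq_matI) (auto simp del: index_mult_mat(1))
      have "mprod T fs * E = E * mprod B fs" for fs
      proof (induction fs)
        case (Cons f fs)
        have "mprod T (f # fs) * E = mshift T f * (mprod T fs * E)"
          using T E by (simp add: assoc_mult_mat[of _ n n _ n _ k])
        also have "\<dots> = mshift T f * E * mprod B fs"
          unfolding Cons using T E B by (simp add: assoc_mult_mat[of _ n n _ k _ k])
        also have "mshift T f * E = E * mshift B f"
          unfolding mshift_mult_mat[OF T E] mat_mult_mshift[OF B E] TE ..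
        also have "E * mshift B f * mprod B fs = E * mprod B (f # fs)"
          using E B by (simp add: assoc_mult_mat[of _ n k _ k _ k])
        finally show ?case .
      qed (use E T B in simp)
      from this[of es] have "P * E = 0\<^sub>m n k"
        unfolding es(2) P_def[symmetric] using E by simp
      then have "R * (P * E) = 0\<^sub>m n k" using R(1) by simp
      then have "E = 0\<^sub>m n k" using RP[OF E] by simp
      then have "E $$ (i, j) = 0" if "i < n" "j < k" for i j using that by simp
      then show ?thesis using P G(1) S(1) unfolding E_def
        by (intro eq_matI) (auto simp del: index_mult_mat(1))
    qed
    then have "R * (P * G) = R * S" by simp
    then show "G = R * S" using RP[OF G(1)] by simp
  qed
qed

subsection \<open>Resolvents\<close>

lemma smult_mat_mult_vec:
  "x \<in> carrier_vec (dim_col M) \<Longrightarrow> (c \<cdot>\<^sub>m M) *\<^sub>v (x :: complex vec) = c \<cdot>\<^sub>v (M *\<^sub>v x)"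
  by (intro eq_vecI) auto

lemma smult_zero_vec [simp]: "c \<cdot>\<^sub>v 0\<^sub>v n = (0\<^sub>v n :: complex vec)"
  by (intro eq_vecI) auto

lemma zero_mat_mult_vec [simp]:
  "x \<in> carrier_vec n \<Longrightarrow> 0\<^sub>m q n *\<^sub>v x = (0\<^sub>v q :: complex vec)"
  by (intro eq_vecI) auto

lemma mat_diff_eqD:
  assumes "M \<in> carrier_mat m n" "N \<in> carrier_mat m n" "M - N = (K :: complex mat)"
  shows "N = M - K"
  using assms(1,2) by (intro eq_matI) (auto simp flip: assms(3))

lemma resolvent:
  assumes "A \<in> carrier_mat n n" "w \<notin> spectrum A"
  defines "R \<equiv> minv (w \<cdot>\<^sub>m 1\<^sub>m n - A)"
  shows "R \<in> carrier_mat n n" "(w \<cdot>\<^sub>m 1\<^sub>m n - A) * R = 1\<^sub>m n" "R * (w \<cdot>\<^sub>m 1\<^sub>m n - A) = 1\<^sub>m n"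
    "A * R = w \<cdot>\<^sub>m R - 1\<^sub>m n" "R * A = w \<cdot>\<^sub>m R - 1\<^sub>m n"
proof -
  let ?M = "w \<cdot>\<^sub>m 1\<^sub>m n - A"
  have M: "?M \<in> carrier_mat n n" using assms by (simp add: minus_carrier_mat)
  have "?M = - mshift A w" using assms(1) by (intro eq_matI) auto
  then have "v = 0\<^sub>v n" if "v \<in> carrier_vec n" "?M *\<^sub>v v = 0\<^sub>v n" for v
    using mshift_injective[OF assms(1,2) that(1)] that assms(1)
    by (simp add: uminus_mult_mat_vec) (metis uminus_uminus_vec uminus_zero_vec)
  from minv[OF M this, folded R_def]
  show *: "R \<in> carrier_mat n n" "?M * R = 1\<^sub>m n" "R * ?M = 1\<^sub>m n" by auto
  have "w \<cdot>\<^sub>m R - A * R = 1\<^sub>m n"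
    using *(1,2) assms(1) minus_mult_distrib_mat[of "w \<cdot>\<^sub>m 1\<^sub>m n" n n A R n]
      mult_smult_assoc_mat[of "1\<^sub>m n" n n R n w] by simp
  then show "A * R = w \<cdot>\<^sub>m R - 1\<^sub>m n"
    using mat_diff_eqD[of "w \<cdot>\<^sub>m R" n n "A * R"] *(1) assms(1) by simp
  have "w \<cdot>\<^sub>m R - R * A = 1\<^sub>m n"
    using *(1,3) assms(1) mult_minus_distrib_mat[of R n n "w \<cdot>\<^sub>m 1\<^sub>m n" n A]
      mult_smult_distrib[of R n n "1\<^sub>m n" n w] by simp
  then show "R * A = w \<cdot>\<^sub>m R - 1\<^sub>m n"
    using mat_diff_eqD[of "w \<cdot>\<^sub>m R" n n "R * A"] *(1) assms(1) by simp
qed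

text \<open>Evaluate \<open>R w * A * R z\<close> twice, absorbing \<open>A\<close> into the left
  and into the right resolvent. Read from left to right, this is partial fractions for two simple
  poles.\<close>

lemma resolvent_identity:
  assumes "A \<in> carrier_mat n n" "w \<notin> spectrum A" "z \<notin> spectrum A" "w \<noteq> z"
  defines "R \<equiv> \<lambda>w. minv (w \<cdot>\<^sub>m 1\<^sub>m n - A)"
  shows "R w * R z = (1 / (z - w)) \<cdot>\<^sub>m (R w - R z)"
proof -
  have W: "R w \<in> carrier_mat n n" "R w * A = w \<cdot>\<^sub>m R w - 1\<^sub>m n"
    unfolding R_def using resolvent[OF assms(1,2)] by auto
  have Z: "R z \<in> carrier_mat n n" "A * R z = z \<cdot>\<^sub>m R z - 1\<^sub>m n"
    unfolding R_def using resolvent[OF assms(1,3)] by auto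
  have "R w * A * R z = w \<cdot>\<^sub>m (R w * R z) - R z"
    unfolding W(2) using W(1) Z(1) by (simp add: minus_mult_distrib_mat[of _ n n] mult_smult_assoc_mat[of _ n n _ n])
  moreover have "R w * (A * R z) = z \<cdot>\<^sub>m (R w * R z) - R w"
    unfolding Z(2) using W(1) Z(1)
    by (simp add: mult_minus_distrib_mat[of "R w" n n _ n] mult_smult_distrib[of "R w" n n "R z" n])
  moreover have "R w * A * R z = R w * (A * R z)" using W(1) Z(1) assms(1) by simp
  ultimately have "w \<cdot>\<^sub>m (R w * R z) - R z = z \<cdot>\<^sub>m (R w * R z) - R w" by simp
  note comps = arg_cong[OF this, of "\<lambda>M. M $$ (i, j)" for i j]
  have "(z - w) * (R w * R z) $$ (i, j) = (R w - R z) $$ (i, j)" if "i < n" "j < n" for i j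
    using comps[of i j] that W(1) Z(1) by (simp del: index_mult_mat(1) add: algebra_simps)
  then show ?thesis using W(1) Z(1) assms(4)
    by (intro eq_matI) (simp_all del: index_mult_mat(1) add: field_simps)
qed

text \<open>Here the head of the list acts first, whereas in \<open>mprod\<close> it acts last.
  Hence the two leading resolvents meet each other next to the vector, and in a mixed product the
  leading resolvent meets the leading factor \<open>A - e\<close>.\<close>

fun rprod :: "complex mat \<Rightarrow> complex list \<Rightarrow> complex mat" where
  "rprod A [] = 1\<^sub>m (dim_row A)"
| "rprod A (w # ws) = rprod A ws * minv (w \<cdot>\<^sub>m 1\<^sub>m (dim_row A) - A)"

lemma rprod_carrier:
  assumes "A \<in> carrier_mat n n" "set ws \<inter> spectrum A = {}"
  shows "rprod A ws \<in> carrier_mat n n"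
  using assms(2) resolvent(1)[OF assms(1)] assms(1) by (induction ws) auto

lemma rprod_Cons_mult:
  assumes "A \<in> carrier_mat n n" "set (w # ws) \<inter> spectrum A = {}" "x \<in> carrier_vec n"
  shows "rprod A (w # ws) *\<^sub>v x = rprod A ws *\<^sub>v (minv (w \<cdot>\<^sub>m 1\<^sub>m n - A) *\<^sub>v x)"
  using assms resolvent(1)[OF assms(1), of w] rprod_carrier[OF assms(1), of ws]
  by (auto intro!: assoc_mult_mat_vec)

text \<open>Partial fractions express a product of resolvents as a combination of single ones.\<close>

lemma rprod_unobserved:
  assumes A: "A \<in> carrier_mat n n" and C: "C \<in> carrier_mat q n" and u: "u \<in> carrier_vec n"
    and "distinct (w # ws)" "set (w # ws) \<inter> spectrum A = {}"
    and "\<And>z. z \<in> set (w # ws) \<Longrightarrow> C *\<^sub>v (minv (z \<cdot>\<^sub>m 1\<^sub>m n - A) *\<^sub>v u) = 0\<^sub>v q"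
  shows "C *\<^sub>v (rprod A (w # ws) *\<^sub>v u) = 0\<^sub>v q"
  using assms(4-)
proof (induction ws arbitrary: w)
  case Nil
  then have "minv (w \<cdot>\<^sub>m 1\<^sub>m n - A) *\<^sub>v u \<in> carrier_vec n"
    using resolvent(1)[OF A, of w] u by (intro mult_mat_vec_carrier) auto
  then show ?case using Nil A u resolvent(1)[OF A, of w] by simp
next
  case (Cons z ws)
  define R where "R = (\<lambda>w. minv (w \<cdot>\<^sub>m 1\<^sub>m n - A))"
  have sp: "w \<notin> spectrum A" "z \<notin> spectrum A" "w \<noteq> z" using Cons.prems by auto
  have R: "R w \<in> carrier_mat n n" "R z \<in> carrier_mat n n"
    using resolvent(1)[OF A sp(1)] resolvent(1)[OF A sp(2)] by (auto simp: R_def)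
  let ?P = "rprod A ws"
  have P: "?P \<in> carrier_mat n n" using rprod_carrier[OF A] Cons.prems by auto
  \<comment> \<open>Splitting the two leading factors leaves two products with one factor fewer. One
    of them keeps \<open>w\<close> and drops \<open>z\<close>, hence the induction with
    \<open>w\<close> arbitrary.\<close>
  have "R z * R w = (1 / (w - z)) \<cdot>\<^sub>m (R z - R w)"
    using resolvent_identity[OF A sp(2,1)] sp(3) unfolding R_def by auto
  then have "R z *\<^sub>v (R w *\<^sub>v u) = (1 / (w - z)) \<cdot>\<^sub>v (R z *\<^sub>v u - R w *\<^sub>v u)"
    using R u by (subst assoc_mult_mat_vec[symmetric, of _ n n _ n])
      (auto simp: smult_mat_mult_vec minus_mult_distrib_mat_vec[of _ n n] minus_carrier_mat)
  then have "rprod A (w # z # ws) *\<^sub>v u = ?P *\<^sub>v ((1 / (w - z)) \<cdot>\<^sub>v (R z *\<^sub>v u - R w *\<^sub>v u))"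
    using Cons.prems A u R P rprod_carrier[OF A, of "z # ws"]
    by (simp add: rprod_Cons_mult[OF A, unfolded R_def[symmetric]] R_def del: rprod.simps)
  also have "\<dots> = (1 / (w - z)) \<cdot>\<^sub>v (?P *\<^sub>v (R z *\<^sub>v u) - ?P *\<^sub>v (R w *\<^sub>v u))"
    using P R u by (simp add: mult_mat_vec[of _ n n] mult_minus_distrib_mat_vec[of _ n n])
  also have "?P *\<^sub>v (R z *\<^sub>v u) = rprod A (z # ws) *\<^sub>v u"
    using Cons.prems by (simp add: rprod_Cons_mult[OF A _ u] R_def del: rprod.simps)
  also have "?P *\<^sub>v (R w *\<^sub>v u) = rprod A (w # ws) *\<^sub>v u"
    using Cons.prems by (simp add: rprod_Cons_mult[OF A _ u] R_def del: rprod.simps)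
  finally have eq: "rprod A (w # z # ws) *\<^sub>v u =
    (1 / (w - z)) \<cdot>\<^sub>v (rprod A (z # ws) *\<^sub>v u - rprod A (w # ws) *\<^sub>v u)" .
  have c: "rprod A (z # ws) *\<^sub>v u \<in> carrier_vec n" "rprod A (w # ws) *\<^sub>v u \<in> carrier_vec n"
    using Cons.prems rprod_carrier[OF A, of "z # ws"] rprod_carrier[OF A, of "w # ws"] u
    by (auto intro!: mult_mat_vec_carrier[of _ n n] simp del: rprod.simps)
  have "C *\<^sub>v (rprod A (z # ws) *\<^sub>v u) = 0\<^sub>v q" "C *\<^sub>v (rprod A (w # ws) *\<^sub>v u) = 0\<^sub>v q"
    using Cons.prems by (intro Cons.IH; force)+
  then show ?case unfolding eq using c C
    by (simp add: mult_mat_vec[of _ q n] mult_minus_distrib_mat_vec[of _ q n] del: rprod.simps)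
qed

text \<open>The matrix in front of \<open>u\<close> is a rational function of \<open>A\<close> with
  simple poles at \<open>ws\<close> and a numerator of smaller degree, hence a combination of single
  resolvents. Each numerator factor is traded by \<open>R (A - e) = (w - e) R - 1\<close>. The
  second term uses up a pole as well, and the strict inequality keeps at least one pole when the
  numerator is exhausted.\<close>

lemma rprod_mprod_unobserved:
  assumes A: "A \<in> carrier_mat n n" and C: "C \<in> carrier_mat q n" and u: "u \<in> carrier_vec n"
    and "distinct ws" "set ws \<inter> spectrum A = {}" "length es < length ws"
    and "\<And>z. z \<in> set ws \<Longrightarrow> C *\<^sub>v (minv (z \<cdot>\<^sub>m 1\<^sub>m n - A) *\<^sub>v u) = 0\<^sub>v q"
  shows "C *\<^sub>v (rprod A ws *\<^sub>v (mprod A es *\<^sub>v u)) = 0\<^sub>v q"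
  using assms(4-)
proof (induction es arbitrary: ws)
  case Nil
  then obtain w ws' where "ws = w # ws'" by (cases ws) auto
  with Nil show ?case using rprod_unobserved[OF A C u, of w ws'] A u by (auto simp del: rprod.simps)
next
  case (Cons e es)
  then obtain w ws' where ws: "ws = w # ws'" by (cases ws) auto
  define R where "R = minv (w \<cdot>\<^sub>m 1\<^sub>m n - A)"
  have sp: "w \<notin> spectrum A" using Cons.prems ws by auto
  note R = resolvent[OF A sp, folded R_def]
  define x where "x = mprod A es *\<^sub>v u"
  have x: "x \<in> carrier_vec n" unfolding x_def by (rule mult_mat_vec_carrier[OF mprod_carrier[OF A] u])
  have ex: "mprod A (e # es) *\<^sub>v u = mshift A e *\<^sub>v x"
    unfolding x_def using A u by (auto intro!: assoc_mult_mat_vec[of _ n n _ n])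
  have "R *\<^sub>v (A *\<^sub>v x) = (R * A) *\<^sub>v x"
    using A x R(1) by (auto intro!: assoc_mult_mat_vec[symmetric])
  also have "\<dots> = w \<cdot>\<^sub>v (R *\<^sub>v x) - x"
    unfolding R(5) using R(1) x by (auto simp: minus_mult_distrib_mat_vec[of _ n n] smult_mat_mult_vec)
  finally have RA: "R *\<^sub>v (A *\<^sub>v x) = w \<cdot>\<^sub>v (R *\<^sub>v x) - x" .
  have "R *\<^sub>v (mshift A e *\<^sub>v x) = R *\<^sub>v (A *\<^sub>v x) - e \<cdot>\<^sub>v (R *\<^sub>v x)"
    unfolding mshift_mult_vec[OF A x] using A R(1) x
    by (simp add: mult_minus_distrib_mat_vec[of _ n n] mult_mat_vec[of _ n n])
  also have "\<dots> = (w - e) \<cdot>\<^sub>v (R *\<^sub>v x) - x"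
    unfolding RA using R(1) x by (intro eq_vecI) (auto simp del: index_mult_mat_vec simp: algebra_simps)
  finally have Rx: "R *\<^sub>v (mshift A e *\<^sub>v x) = (w - e) \<cdot>\<^sub>v (R *\<^sub>v x) - x" .
  let ?P = "rprod A ws'"
  have P: "?P \<in> carrier_mat n n" using rprod_carrier[OF A] Cons.prems ws by auto
  have "rprod A ws *\<^sub>v (mprod A (e # es) *\<^sub>v u) = ?P *\<^sub>v (R *\<^sub>v (mshift A e *\<^sub>v x))"
    unfolding ex ws R_def using Cons.prems ws A x
    by (intro rprod_Cons_mult[OF A]) (auto intro!: mult_mat_vec_carrier[of _ n n])
  also have "\<dots> = (w - e) \<cdot>\<^sub>v (?P *\<^sub>v (R *\<^sub>v x)) - ?P *\<^sub>v x"
    unfolding Rx using P R(1) x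
    by (simp add: mult_minus_distrib_mat_vec[of _ n n] mult_mat_vec[of _ n n])
  also have "?P *\<^sub>v (R *\<^sub>v x) = rprod A ws *\<^sub>v x"
    unfolding ws R_def using Cons.prems ws by (intro rprod_Cons_mult[OF A _ x, symmetric]) auto
  finally have eq: "rprod A ws *\<^sub>v (mprod A (e # es) *\<^sub>v u) =
    (w - e) \<cdot>\<^sub>v (rprod A ws *\<^sub>v x) - ?P *\<^sub>v x" .
  have "rprod A ws \<in> carrier_mat n n" using rprod_carrier[OF A] Cons.prems by auto
  then have c: "rprod A ws *\<^sub>v x \<in> carrier_vec n" "?P *\<^sub>v x \<in> carrier_vec n"
    using P x by (auto intro: mult_mat_vec_carrier)
  have "C *\<^sub>v (rprod A ws *\<^sub>v x) = 0\<^sub>v q" "C *\<^sub>v (?P *\<^sub>v x) = 0\<^sub>v q"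
    unfolding x_def using Cons.prems ws by (intro Cons.IH; force)+
  then show ?case unfolding eq using c C
    by (simp add: mult_mat_vec[of _ q n] mult_minus_distrib_mat_vec[of _ q n])
qed

text \<open>The empty product keeps \<open>u\<close> nonzero and the full product kills it, so some
  factor is the first to give zero, and it acts on an eigenvector. The strict length bound is what
  makes the rational function in \<open>rprod_mprod_unobserved\<close> proper.\<close>

lemma mprod_first_zero:
  assumes "A \<in> carrier_mat n n" "u \<in> carrier_vec n" "u \<noteq> 0\<^sub>v n" "mprod A es *\<^sub>v u = 0\<^sub>v n"
  shows "\<exists>e fs. length fs < length es \<and> mprod A fs *\<^sub>v u \<noteq> 0\<^sub>v n \<and>
    mshift A e *\<^sub>v (mprod A fs *\<^sub>v u) = 0\<^sub>v n"
  using assms(4)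
proof (induction es)
  case (Cons e es)
  show ?case
  proof (cases "mprod A es *\<^sub>v u = 0\<^sub>v n")
    case True
    with Cons.IH show ?thesis by (metis length_Cons less_Suc_eq)
  next
    case False
    moreover have "mshift A e *\<^sub>v (mprod A es *\<^sub>v u) = 0\<^sub>v n"
      using Cons.prems assms by (subst assoc_mult_mat_vec[symmetric, of _ n n _ n]) auto
    ultimately show ?thesis by fastforce
  qed
qed (use assms in simp)

text \<open>If \<open>u\<close> is in the common kernel, a partial product of the annihilating factors \<open>A - e\<close> maps
  \<open>u\<close> to an eigenvector \<open>v\<close>. The resolvents only rescale \<open>v\<close>, so partial fractions give \<open>C v = 0\<close>.\<close>

lemma hautus_separating:
  assumes A: "A \<in> carrier_mat n n" and C: "C \<in> carrier_mat q n"
    and inf: "infinite \<Omega>" and disj: "\<Omega> \<inter> spectrum A = {}"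
    and hautus: "\<And>e v. v \<in> carrier_vec n \<Longrightarrow> A *\<^sub>v v = e \<cdot>\<^sub>v v \<Longrightarrow> C *\<^sub>v v = 0\<^sub>v q \<Longrightarrow> v = 0\<^sub>v n"
  obtains S where "finite S" "S \<subseteq> \<Omega>"
    "\<forall>u \<in> carrier_vec n.
      (\<forall>w \<in> S. C *\<^sub>v (minv (w \<cdot>\<^sub>m 1\<^sub>m n - A) *\<^sub>v u) = 0\<^sub>v q) \<longrightarrow> u = 0\<^sub>v n"
proof -
  obtain es where es: "mprod A es = 0\<^sub>m n n" using annihilating_product[OF A] .
  \<comment> \<open>One sample point per annihilating factor suffices, since the list
    \<open>fs\<close> found below is strictly shorter than \<open>es\<close>.\<close>
  obtain S where S: "finite S" "card S = length es" "S \<subseteq> \<Omega>"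
    using infinite_arbitrarily_large[OF inf] by blast
  obtain ws where ws: "set ws = S" "distinct ws" using finite_distinct_list[OF S(1)] by blast
  have "u = 0\<^sub>v n" if u: "u \<in> carrier_vec n"
    and z: "\<forall>w \<in> S. C *\<^sub>v (minv (w \<cdot>\<^sub>m 1\<^sub>m n - A) *\<^sub>v u) = 0\<^sub>v q" for u
  proof (rule ccontr)
    assume "u \<noteq> 0\<^sub>v n"
    moreover have "mprod A es *\<^sub>v u = 0\<^sub>v n" unfolding es using u by auto
    ultimately obtain e fs where fs: "length fs < length es" "mprod A fs *\<^sub>v u \<noteq> 0\<^sub>v n"
      "mshift A e *\<^sub>v (mprod A fs *\<^sub>v u) = 0\<^sub>v n"
      using mprod_first_zero[OF A u] by blast
    define v where "v = mprod A fs *\<^sub>v u"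
    have v: "v \<in> carrier_vec n" unfolding v_def by (rule mult_mat_vec_carrier[OF mprod_carrier[OF A] u])
    have "(A *\<^sub>v v) $ i = (e \<cdot>\<^sub>v v) $ i" if "i < n" for i
      using arg_cong[OF fs(3)[folded v_def, unfolded mshift_mult_vec[OF A v]], of "\<lambda>v. vec_index v i"] that A v
      by (auto simp del: index_mult_mat_vec)
    then have Av: "A *\<^sub>v v = e \<cdot>\<^sub>v v" using A v by (intro eq_vecI) auto
    have "e \<in> spectrum A" using Av v fs(2) v_def by (auto simp: spectrum_iff[OF A])
    have Rv: "\<exists>c. c \<noteq> 0 \<and> rprod A xs *\<^sub>v v = c \<cdot>\<^sub>v v" if "set xs \<subseteq> \<Omega>" for xs
      using that
    proof (induction xs)
      case Nil
      then show ?case using A v by (intro exI[of _ 1]) auto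
    next
      case (Cons w xs)
      then obtain c where c: "c \<noteq> 0" "rprod A xs *\<^sub>v v = c \<cdot>\<^sub>v v" by auto
      define R where "R = minv (w \<cdot>\<^sub>m 1\<^sub>m n - A)"
      have sp: "w \<notin> spectrum A" "set (w # xs) \<inter> spectrum A = {}" using Cons.prems disj by auto
      note R = resolvent[OF A sp(1), folded R_def]
      have "R *\<^sub>v (A *\<^sub>v v) = (R * A) *\<^sub>v v"
        using A v R(1) by (auto intro!: assoc_mult_mat_vec[symmetric])
      also have "\<dots> = w \<cdot>\<^sub>v (R *\<^sub>v v) - v"
        unfolding R(5) using R(1) v
        by (auto simp: minus_mult_distrib_mat_vec[of _ n n] smult_mat_mult_vec)
      finally have "e \<cdot>\<^sub>v (R *\<^sub>v v) = w \<cdot>\<^sub>v (R *\<^sub>v v) - v"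
        unfolding Av using R(1) v by (simp add: mult_mat_vec[of _ n n])
      note comps = arg_cong[OF this, of "\<lambda>v. vec_index v i" for i]
      have "(w - e) * (R *\<^sub>v v) $ i = v $ i" if "i < n" for i
        using comps[of i] that R(1) v by (auto simp del: index_mult_mat_vec simp: algebra_simps)
      moreover have we: "w \<noteq> e" using sp \<open>e \<in> spectrum A\<close> by auto
      ultimately have "R *\<^sub>v v = (1 / (w - e)) \<cdot>\<^sub>v v"
        using R(1) v by (intro eq_vecI) (auto simp del: index_mult_mat_vec simp: field_simps)
      moreover have "rprod A (w # xs) *\<^sub>v v = rprod A xs *\<^sub>v (R *\<^sub>v v)"
        unfolding R_def by (rule rprod_Cons_mult[OF A sp(2) v])
      ultimately have "rprod A (w # xs) *\<^sub>v v = (1 / (w - e) * c) \<cdot>\<^sub>v v"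
        using c rprod_carrier[OF A, of xs] sp v by (simp add: mult_mat_vec[of _ n n] smult_smult_assoc)
      then show ?case using we c by (intro exI[of _ "1 / (w - e) * c"]) auto
    qed
    have "C *\<^sub>v (rprod A ws *\<^sub>v v) = 0\<^sub>v q"
      unfolding v_def
      using ws S fs(1) disj z distinct_card[OF ws(2)] by (intro rprod_mprod_unobserved[OF A C u]) auto
    moreover obtain c where c: "c \<noteq> 0" "rprod A ws *\<^sub>v v = c \<cdot>\<^sub>v v" using Rv[of ws] ws S by auto
    ultimately have "c \<cdot>\<^sub>v (C *\<^sub>v v) = 0\<^sub>v q" using C v by (simp add: mult_mat_vec[of _ q n])
    note comps = arg_cong[OF this, of "\<lambda>v. vec_index v i" for i]
    have "(C *\<^sub>v v) $ i = 0" if "i < q" for i using comps[of i] that C c by (simp del: index_mult_mat_vec)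
    then have "C *\<^sub>v v = 0\<^sub>v q" using C by (intro eq_vecI) (auto simp del: index_mult_mat_vec)
    from hautus[OF v Av this] fs(2) show False by (simp add: v_def)
  qed
  then show thesis by (intro that[OF S(1,3)] ballI impI)
qed

text \<open>The Gram matrix \<open>\<Sum> E(w)\<^sup>* E(w)\<close> is injective, and its range lies in \<open>L\<close>.\<close>

lemma separating_span:
  fixes E :: "'i \<Rightarrow> complex mat"
  assumes "finite S" and E: "\<And>w. w \<in> S \<Longrightarrow> E w \<in> carrier_mat q n"
    and sep: "\<And>u. u \<in> carrier_vec n \<Longrightarrow> (\<And>w. w \<in> S \<Longrightarrow> E w *\<^sub>v u = 0\<^sub>v q) \<Longrightarrow> u = 0\<^sub>v n"
    and zero: "0\<^sub>v n \<in> L" and add: "\<And>x y. x \<in> L \<Longrightarrow> y \<in> L \<Longrightarrow> x + y \<in> L"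
    and gen: "\<And>w y. w \<in> S \<Longrightarrow> y \<in> carrier_vec q \<Longrightarrow> mat_adjoint (E w) *\<^sub>v y \<in> L"
    and v: "v \<in> carrier_vec n"
  shows "v \<in> L"
proof -
  \<comment> \<open>The Gram matrix is grown one point at a time. Nonnegativity of its form is
    carried along because a sum of nonnegative terms vanishes only if each term does.\<close>
  have "\<exists>G \<in> carrier_mat n n. (\<forall>x \<in> carrier_vec n. G *\<^sub>v x \<in> L \<and> 0 \<le> Re ((G *\<^sub>v x) \<bullet>c x) \<and>
      (Re ((G *\<^sub>v x) \<bullet>c x) = 0 \<longrightarrow> (\<forall>w \<in> S'. E w *\<^sub>v x = 0\<^sub>v q)))"
    if "finite S'" "S' \<subseteq> S" for S'
    using that
  proof (induction S' rule: finite_induct)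
    case empty
    show ?case using zero by (intro bexI[of _ "0\<^sub>m n n"]) auto
  next
    case (insert w S')
    then obtain G where G: "G \<in> carrier_mat n n"
      "\<And>x. x \<in> carrier_vec n \<Longrightarrow> G *\<^sub>v x \<in> L"
      "\<And>x. x \<in> carrier_vec n \<Longrightarrow> 0 \<le> Re ((G *\<^sub>v x) \<bullet>c x)"
      "\<And>x w. x \<in> carrier_vec n \<Longrightarrow> Re ((G *\<^sub>v x) \<bullet>c x) = 0 \<Longrightarrow> w \<in> S' \<Longrightarrow> E w *\<^sub>v x = 0\<^sub>v q"
      by blast
    have w: "E w \<in> carrier_mat q n" using insert E by auto
    let ?M = "mat_adjoint (E w) * E w"
    have M: "?M \<in> carrier_mat n n" using w by (intro mult_carrier_mat) auto
    have Mx: "?M *\<^sub>v x = mat_adjoint (E w) *\<^sub>v (E w *\<^sub>v x)" if "x \<in> carrier_vec n" for x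
      using w that by (intro assoc_mult_mat_vec) auto
    have ip: "(?M *\<^sub>v x) \<bullet>c x = (E w *\<^sub>v x) \<bullet>c (E w *\<^sub>v x)" if "x \<in> carrier_vec n" for x
      unfolding Mx[OF that] using w that by (subst cscalar_mat_adjoint[of _ n q]) auto
    have sum: "((G + ?M) *\<^sub>v x) = G *\<^sub>v x + ?M *\<^sub>v x" if "x \<in> carrier_vec n" for x
      using G(1) M that by (intro add_mult_distrib_mat_vec) auto
    have ip2: "Re (((G + ?M) *\<^sub>v x) \<bullet>c x) = Re ((G *\<^sub>v x) \<bullet>c x) + Re ((E w *\<^sub>v x) \<bullet>c (E w *\<^sub>v x))"
      if "x \<in> carrier_vec n" for x
      unfolding sum[OF that] using G(1) M that ip
      by (subst add_scalar_prod_distrib[of _ n]) auto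
    have Ex: "E w *\<^sub>v x \<in> carrier_vec q" if "x \<in> carrier_vec n" for x using w that by simp
    show ?case
    proof (intro bexI[of _ "G + ?M"] ballI conjI impI)
      fix x :: "complex vec" assume x: "x \<in> carrier_vec n"
      show "(G + ?M) *\<^sub>v x \<in> L"
        unfolding sum[OF x] Mx[OF x] using insert x Ex by (intro add G(2) gen) auto
      show "0 \<le> Re (((G + ?M) *\<^sub>v x) \<bullet>c x)"
        unfolding ip2[OF x] using G(3)[OF x] cscalar_self(2)[OF Ex[OF x]] by simp
      fix w' assume z: "Re (((G + ?M) *\<^sub>v x) \<bullet>c x) = 0" and w': "w' \<in> insert w S'"
      have "Re ((G *\<^sub>v x) \<bullet>c x) = 0" "Re ((E w *\<^sub>v x) \<bullet>c (E w *\<^sub>v x)) = 0"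
        using z G(3)[OF x] cscalar_self(2)[OF Ex[OF x]] unfolding ip2[OF x] by linarith+
      with w' show "E w' *\<^sub>v x = 0\<^sub>v q" using G(4)[OF x] cscalar_self(3)[OF Ex[OF x]] by auto
    qed (use G M in simp)
  qed
  from this[OF assms(1)] obtain G where G: "G \<in> carrier_mat n n"
    "\<And>x. x \<in> carrier_vec n \<Longrightarrow> G *\<^sub>v x \<in> L"
    "\<And>x w. x \<in> carrier_vec n \<Longrightarrow> Re ((G *\<^sub>v x) \<bullet>c x) = 0 \<Longrightarrow> w \<in> S \<Longrightarrow> E w *\<^sub>v x = 0\<^sub>v q"
    by blast
  have "x = 0\<^sub>v n" if "x \<in> carrier_vec n" "G *\<^sub>v x = 0\<^sub>v n" for x
    using that G(3) by (intro sep) auto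
  note N = minv[OF G(1) this]
  have "v = (G * minv G) *\<^sub>v v" using v by (simp add: N(2))
  also have "\<dots> = G *\<^sub>v (minv G *\<^sub>v v)" using G(1) N(1) v by (intro assoc_mult_mat_vec) auto
  also have "\<dots> \<in> L" using N(1) v by (intro G(2) mult_mat_vec_carrier) auto
  finally show ?thesis .
qed

subsection \<open>Reproducing kernels of finite rank\<close>

text \<open>Riesz representation in finite dimension, for the conjugate-linear second slot of a
  form. The values on unit vectors give \<open>g\<close>; truncations of \<open>v\<close> extend the
  formula one coordinate at a time.\<close>

lemma conj_linear_functional:
  fixes \<phi> :: "complex vec \<Rightarrow> complex"
  assumes add: "\<And>x y. x \<in> carrier_vec n \<Longrightarrow> y \<in> carrier_vec n \<Longrightarrow> \<phi> (x + y) = \<phi> x + \<phi> y"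
    and smult: "\<And>c x. x \<in> carrier_vec n \<Longrightarrow> \<phi> (c \<cdot>\<^sub>v x) = cnj c * \<phi> x"
  obtains g where "g \<in> carrier_vec n" "\<And>v. v \<in> carrier_vec n \<Longrightarrow> \<phi> v = g \<bullet>c v"
proof -
  define g where "g = vec n (\<lambda>i. \<phi> (unit_vec n i))"
  have "\<phi> v = g \<bullet>c v" if v: "v \<in> carrier_vec n" for v
  proof -
    have "\<phi> (vec n (\<lambda>i. if i < k then v $ i else 0)) = (\<Sum>i<k. cnj (v $ i) * \<phi> (unit_vec n i))"
      if "k \<le> n" for k
      using that
    proof (induction k)
      case 0
      have "vec n (\<lambda>i. if i < 0 then v $ i else 0) = 0 \<cdot>\<^sub>v (0\<^sub>v n :: complex vec)"
        by (intro eq_vecI) auto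
      then show ?case using smult[of "0\<^sub>v n" 0] by simp
    next
      case (Suc k)
      let ?w = "vec n (\<lambda>i. if i < k then v $ i else 0)"
      have "vec n (\<lambda>i. if i < Suc k then v $ i else 0) = ?w + v $ k \<cdot>\<^sub>v unit_vec n k"
        using Suc.prems by (intro eq_vecI) (auto simp: less_Suc_eq)
      moreover have "\<phi> (?w + v $ k \<cdot>\<^sub>v unit_vec n k) = \<phi> ?w + cnj (v $ k) * \<phi> (unit_vec n k)"
        by (subst add) (auto simp: smult)
      ultimately show ?case using Suc by simp
    qed
    from this[of n] have "\<phi> (vec n (\<lambda>i. if i < n then v $ i else 0)) = g \<bullet>c v"
      using v by (simp add: g_def scalar_prod_def atLeast0LessThan mult.commute)
    moreover have "vec n (\<lambda>i. if i < n then v $ i else 0) = v"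
      using v by (intro eq_vecI) auto
    ultimately show ?thesis by simp
  qed
  moreover have "g \<in> carrier_vec n" by (simp add: g_def)
  ultimately show thesis by (intro that)
qed

lemma fun_space_simps [simp]:
  "carrier (fun_space q \<Omega> H) = H"
  "zero (fun_space q \<Omega> H) = (\<lambda>z\<in>\<Omega>. 0\<^sub>v q)"
  "f \<oplus>\<^bsub>fun_space q \<Omega> H\<^esub> g = (\<lambda>z\<in>\<Omega>. f z + g z)"
  "c \<odot>\<^bsub>fun_space q \<Omega> H\<^esub> f = (\<lambda>z\<in>\<Omega>. c \<cdot>\<^sub>v f z)"
  by (simp_all add: fun_space_def)

text \<open>Completeness is inherited from the positive part, because the negative part is trivial.\<close>

lemma pontryagin_positive_hilbert:
  assumes pont: "pontryagin_space V ip"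
    and pos: "\<And>x. x \<in> carrier V \<Longrightarrow> x \<noteq> \<zero>\<^bsub>V\<^esub> \<Longrightarrow> 0 < Re (ip x x)"
  shows "hilbert_space V ip"
proof -
  obtain P N where PN: "subspace class_ring P V" "subspace class_ring N V"
      "carrier V = {x \<oplus>\<^bsub>V\<^esub> y |x y. x \<in> P \<and> y \<in> N}"
      "hilbert_space (V\<lparr>carrier := P\<rparr>) ip" "hilbert_space (V\<lparr>carrier := N\<rparr>) (\<lambda>x y. - ip x y)"
    and vs: "vectorspace class_ring V"
    using pont unfolding pontryagin_space_def by blast
  interpret vectorspace class_ring V by (rule vs)
  have sub: "P \<subseteq> carrier V" "N \<subseteq> carrier V"
    using PN(1,2) by (auto simp: subspace_def submodule_def)
  have zero: "y = \<zero>\<^bsub>V\<^esub>" if "y \<in> N" for y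
  proof (rule ccontr)
    assume nz: "y \<noteq> \<zero>\<^bsub>V\<^esub>"
    then have "0 < Re (- ip y y)" using PN(5) that by (auto simp: hilbert_space_def)
    with pos[of y] nz that sub show False by auto
  qed
  have "x \<in> P" if "x \<in> carrier V" for x
  proof -
    obtain a b where ab: "a \<in> P" "b \<in> N" "x = a \<oplus>\<^bsub>V\<^esub> b"
      using \<open>x \<in> carrier V\<close> unfolding PN(3) by blast
    moreover have "a \<oplus>\<^bsub>V\<^esub> \<zero>\<^bsub>V\<^esub> = a" using ab(1) sub(1) by (intro M.r_zero) blast
    ultimately show ?thesis using zero by simp
  qed
  \<comment> \<open>Replacing the carrier by \<open>P\<close> now leaves the record unchanged, so
    the completeness known for \<open>P\<close> is literally that of \<open>V\<close>.\<close>
  then have "carrier V = P" using sub(1) by blast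
  then have "V\<lparr>carrier := P\<rparr> = V" by simp
  with PN(4) show ?thesis by simp
qed

text \<open>The functions \<open>F v = E(\<cdot>) Q v\<close> fill \<open>H\<close>, with \<open>[F u, F v] = v\<^sup>* Q u\<close>: any \<open>f \<in> H\<close> agrees with some
  \<open>F u\<close> in all inner products with kernel functions, hence pointwise.\<close>

lemma finite_rank_kernel_hilbert_iff:
  fixes E :: "complex \<Rightarrow> complex mat"
  assumes E: "\<And>z. z \<in> \<Omega> \<Longrightarrow> E z \<in> carrier_mat q n"
    and P: "P \<in> carrier_mat n n" "Q \<in> carrier_mat n n" "P * Q = 1\<^sub>m n" "Q * P = 1\<^sub>m n"
    and fin: "finite S" "S \<subseteq> \<Omega>"
    and sep: "\<And>u. u \<in> carrier_vec n \<Longrightarrow> (\<And>w. w \<in> S \<Longrightarrow> E w *\<^sub>v u = 0\<^sub>v q) \<Longrightarrow> u = 0\<^sub>v n"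
    and K: "\<And>z w. z \<in> \<Omega> \<Longrightarrow> w \<in> \<Omega> \<Longrightarrow> K z w = E z * Q * mat_adjoint (E w)"
    and rk: "reproducing_kernel_pontryagin_space q \<Omega> K H ip"
  shows "hilbert_space (fun_space q \<Omega> H) ip \<longleftrightarrow>
    (\<forall>v \<in> carrier_vec n. v \<noteq> 0\<^sub>v n \<longrightarrow> 0 < Re ((P *\<^sub>v v) \<bullet>c v))"
proof -
  let ?V = "fun_space q \<Omega> H"
  have H: "H \<subseteq> \<Omega> \<rightarrow>\<^sub>E carrier_vec q" and pont: "pontryagin_space ?V ip"
    and ker: "\<And>w y. w \<in> \<Omega> \<Longrightarrow> y \<in> carrier_vec q \<Longrightarrow> (\<lambda>z\<in>\<Omega>. K z w *\<^sub>v y) \<in> H"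
    and repr: "\<And>w y f. w \<in> \<Omega> \<Longrightarrow> y \<in> carrier_vec q \<Longrightarrow> f \<in> H \<Longrightarrow>
      ip f (\<lambda>z\<in>\<Omega>. K z w *\<^sub>v y) = f w \<bullet>c y"
    using rk unfolding reproducing_kernel_pontryagin_space_def by blast+
  have vs: "vectorspace class_ring ?V" and herm: "hermitian_form ?V ip"
    using pont by (auto simp: pontryagin_space_def)
  interpret V: vectorspace class_ring ?V by (rule vs)
  \<comment> \<open>Normalized with \<open>Q\<close> so that \<open>F\<close> maps the adjoint of
    \<open>E w\<close>, applied to \<open>y\<close>, to the kernel function at \<open>w\<close> and
    \<open>y\<close> (\<open>F_gen\<close>).\<close>
  define F where "F v = (\<lambda>z\<in>\<Omega>. E z *\<^sub>v (Q *\<^sub>v v))" for v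
  have addH: "(\<lambda>z\<in>\<Omega>. f z + g z) \<in> H" if "f \<in> H" "g \<in> H" for f g
    using V.M.a_closed[of f g] that by simp
  have smultH: "(\<lambda>z\<in>\<Omega>. c \<cdot>\<^sub>v f z) \<in> H" if "f \<in> H" for c f
    using V.smult_closed[of c f] that by (simp add: class_ring_simps)
  have zeroH: "(\<lambda>z\<in>\<Omega>. 0\<^sub>v q) \<in> H"
    using V.M.zero_closed by simp
  note hf = herm[unfolded hermitian_form_def fun_space_simps]
  have ip_add: "ip (\<lambda>z\<in>\<Omega>. f z + g z) h = ip f h + ip g h" if "f \<in> H" "g \<in> H" "h \<in> H" for f g h
    using hf that by blast
  have ip_smult: "ip (\<lambda>z\<in>\<Omega>. c \<cdot>\<^sub>v f z) h = c * ip f h" if "f \<in> H" "h \<in> H" for c f h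
    using hf that by blast
  have ip_swap: "ip g f = cnj (ip f g)" if "f \<in> H" "g \<in> H" for f g
    using hf that by blast
  have ip_add_right: "ip h (\<lambda>z\<in>\<Omega>. f z + g z) = ip h f + ip h g"
    if "f \<in> H" "g \<in> H" "h \<in> H" for f g h
  proof -
    have "ip h (\<lambda>z\<in>\<Omega>. f z + g z) = cnj (ip (\<lambda>z\<in>\<Omega>. f z + g z) h)"
      using that by (intro ip_swap addH)
    also have "\<dots> = cnj (ip f h) + cnj (ip g h)" using that by (simp add: ip_add)
    also have "cnj (ip f h) = ip h f" by (rule ip_swap[symmetric, OF that(1,3)])
    also have "cnj (ip g h) = ip h g" by (rule ip_swap[symmetric, OF that(2,3)])
    finally show ?thesis .
  qed
  have ip_smult_right: "ip h (\<lambda>z\<in>\<Omega>. c \<cdot>\<^sub>v f z) = cnj c * ip h f" if "f \<in> H" "h \<in> H" for c f h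
  proof -
    have "ip h (\<lambda>z\<in>\<Omega>. c \<cdot>\<^sub>v f z) = cnj (ip (\<lambda>z\<in>\<Omega>. c \<cdot>\<^sub>v f z) h)"
      using that by (intro ip_swap smultH)
    also have "\<dots> = cnj c * cnj (ip f h)" using that by (simp add: ip_smult)
    also have "cnj (ip f h) = ip h f" by (rule ip_swap[symmetric, OF that])
    finally show ?thesis .
  qed
  have Qv: "Q *\<^sub>v v \<in> carrier_vec n" if "v \<in> carrier_vec n" for v
    using P(2) that by simp
  have EQ: "E z *\<^sub>v (Q *\<^sub>v v) \<in> carrier_vec q" if "z \<in> \<Omega>" "v \<in> carrier_vec n" for z v
    by (rule mult_mat_vec_carrier[OF E[OF that(1)] Qv[OF that(2)]])
  have F_add: "F (u + v) = (\<lambda>z\<in>\<Omega>. F u z + F v z)" if "u \<in> carrier_vec n" "v \<in> carrier_vec n" for u v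
    unfolding F_def mult_add_distrib_mat_vec[OF P(2) that]
    by (rule restrict_ext) (simp add: mult_add_distrib_mat_vec[OF E Qv[OF that(1)] Qv[OF that(2)]])
  have F_smult: "F (c \<cdot>\<^sub>v v) = (\<lambda>z\<in>\<Omega>. c \<cdot>\<^sub>v F v z)" if "v \<in> carrier_vec n" for c v
    unfolding F_def mult_mat_vec[OF P(2) that]
    by (rule restrict_ext) (simp add: mult_mat_vec[OF E Qv[OF that]])
  have F_zero: "F (0\<^sub>v n) = (\<lambda>z\<in>\<Omega>. 0\<^sub>v q)"
  proof -
    have "Q *\<^sub>v 0\<^sub>v n = 0\<^sub>v n" using P(2) by (intro eq_vecI) auto
    moreover have "E z *\<^sub>v 0\<^sub>v n = 0\<^sub>v q" if "z \<in> \<Omega>" for z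
      using E[OF that] by (intro eq_vecI) auto
    ultimately show ?thesis unfolding F_def by (auto intro: restrict_ext)
  qed
  have Ead: "mat_adjoint (E w) *\<^sub>v y \<in> carrier_vec n" if "w \<in> \<Omega>" "y \<in> carrier_vec q" for w y
    by (rule mult_mat_vec_carrier[OF mat_adjoint_carrier[OF E[OF that(1)]] that(2)])
  have F_gen: "F (mat_adjoint (E w) *\<^sub>v y) = (\<lambda>z\<in>\<Omega>. K z w *\<^sub>v y)"
    if w: "w \<in> \<Omega>" and y: "y \<in> carrier_vec q" for w y
    unfolding F_def
  proof (rule restrict_ext)
    fix z assume z: "z \<in> \<Omega>"
    have "K z w *\<^sub>v y = (E z * Q) *\<^sub>v (mat_adjoint (E w) *\<^sub>v y)"
      unfolding K[OF z w] using E[OF z] E[OF w] P(2) y by (intro assoc_mult_mat_vec[of _ q n]) auto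
    also have "\<dots> = E z *\<^sub>v (Q *\<^sub>v (mat_adjoint (E w) *\<^sub>v y))"
      using E[OF z] P(2) Ead[OF w y] by (intro assoc_mult_mat_vec)
    finally show "E z *\<^sub>v (Q *\<^sub>v (mat_adjoint (E w) *\<^sub>v y)) = K z w *\<^sub>v y" ..
  qed
  \<comment> \<open>The form obeys its laws only on \<open>H\<close>, and it is not yet known which
    \<open>F u\<close> lie there. So membership and the formula for the form are proved together,
    with the formula conditional on \<open>F u \<in> H\<close>. The reproducing property puts the
    kernel functions in, and \<open>separating_span\<close> does the rest.\<close>
  define L where "L = {v \<in> carrier_vec n. F v \<in> H \<and>
    (\<forall>u \<in> carrier_vec n. F u \<in> H \<longrightarrow> ip (F u) (F v) = (Q *\<^sub>v u) \<bullet>c v)}"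
  have L: "v \<in> L" if "v \<in> carrier_vec n" for v
  proof (rule separating_span[OF fin(1) _ sep _ _ _ that])
    show "E w \<in> carrier_mat q n" if "w \<in> S" for w using that fin E by auto
    have "ip f (\<lambda>z\<in>\<Omega>. 0\<^sub>v q) = 0" if "f \<in> H" for f
    proof -
      have "(\<lambda>z\<in>\<Omega>. 0 \<cdot>\<^sub>v (\<lambda>z\<in>\<Omega>. 0\<^sub>v q) z) = (\<lambda>z\<in>\<Omega>. 0\<^sub>v q :: complex vec)"
        by (auto intro!: restrict_ext)
      then show ?thesis using ip_smult_right[OF zeroH that, of 0] by simp
    qed
    then show "0\<^sub>v n \<in> L" using zeroH Qv by (auto simp: L_def F_zero)
    show "x + y \<in> L" if xy: "x \<in> L" "y \<in> L" for x y
    proof -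
      have "(Q *\<^sub>v u) \<bullet>c (x + y) = (Q *\<^sub>v u) \<bullet>c x + (Q *\<^sub>v u) \<bullet>c y" if "u \<in> carrier_vec n" for u
        using xy that P(2) Qv[OF that] 
        by (auto simp: L_def conjugate_add_vec[of _ n] scalar_prod_add_distrib[of _ n])
      then show ?thesis using xy
        by (auto simp: L_def F_add addH ip_add_right)
    qed
    show "mat_adjoint (E w) *\<^sub>v y \<in> L" if wy: "w \<in> S" "y \<in> carrier_vec q" for w y
    proof -
      have w: "w \<in> \<Omega>" using fin wy by auto
      have "ip (F u) (\<lambda>z\<in>\<Omega>. K z w *\<^sub>v y) = (Q *\<^sub>v u) \<bullet>c (mat_adjoint (E w) *\<^sub>v y)"
        if "u \<in> carrier_vec n" "F u \<in> H" for u
      proof -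
        have "ip (F u) (\<lambda>z\<in>\<Omega>. K z w *\<^sub>v y) = (E w *\<^sub>v (Q *\<^sub>v u)) \<bullet>c y"
          using repr[OF w wy(2) that(2)] w by (simp add: F_def)
        then show ?thesis using cscalar_mat_adjoint[OF E[OF w] Qv[OF that(1)] wy(2)] by simp
      qed
      then show ?thesis using ker[OF w wy(2)] Ead[OF w wy(2)] by (simp add: L_def F_gen[OF w wy(2)])
    qed
  qed
  have FH: "F v \<in> H" if "v \<in> carrier_vec n" for v using L[OF that] by (simp add: L_def)
  have ipF: "ip (F u) (F v) = (Q *\<^sub>v u) \<bullet>c v" if "u \<in> carrier_vec n" "v \<in> carrier_vec n" for u v
    using L[OF that(2)] FH[OF that(1)] that(1) by (simp add: L_def)
  have QP: "Q *\<^sub>v (P *\<^sub>v v) = v" if "v \<in> carrier_vec n" for v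
    using P that by (subst assoc_mult_mat_vec[symmetric, of _ n n _ n]) auto
  have surj: "\<exists>u \<in> carrier_vec n. f = F u" if f: "f \<in> H" for f
  proof -
    obtain g where g: "g \<in> carrier_vec n" "\<And>v. v \<in> carrier_vec n \<Longrightarrow> ip f (F v) = g \<bullet>c v"
    proof (rule conj_linear_functional[of n "\<lambda>v. ip f (F v)"])
      fix x y :: "complex vec" and c
      assume x: "x \<in> carrier_vec n"
      then show "ip f (F (c \<cdot>\<^sub>v x)) = cnj c * ip f (F x)"
        by (simp add: F_smult ip_smult_right FH f)
      assume "y \<in> carrier_vec n"
      with x show "ip f (F (x + y)) = ip f (F x) + ip f (F y)"
        by (simp add: F_add ip_add_right FH f)
    qed blast
    \<comment> \<open>By \<open>ipF\<close> the representing vector of \<open>F u\<close> is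
      \<open>Q *\<^sub>v u\<close>, so matching it with \<open>g\<close> forces u = P g.\<close>
    have Pg: "P *\<^sub>v g \<in> carrier_vec n" using P(1) g(1) by simp
    have "f w = F (P *\<^sub>v g) w" if w: "w \<in> \<Omega>" for w
    proof (rule cscalar_eqI[of _ q])
      show "f w \<in> carrier_vec q" "F (P *\<^sub>v g) w \<in> carrier_vec q"
        using f FH[OF Pg] H w by (auto dest!: PiE_mem)
      fix y :: "complex vec" assume y: "y \<in> carrier_vec q"
      let ?b = "mat_adjoint (E w) *\<^sub>v y"
      have "f w \<bullet>c y = ip f (F ?b)" using repr[OF w y f] by (simp add: F_gen[OF w y])
      also have "\<dots> = ip (F (P *\<^sub>v g)) (F ?b)"
        unfolding ipF[OF Pg Ead[OF w y]] QP[OF g(1)] by (rule g(2)[OF Ead[OF w y]])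
      also have "\<dots> = F (P *\<^sub>v g) w \<bullet>c y"
        using repr[OF w y FH[OF Pg]] by (simp add: F_gen[OF w y])
      finally show "f w \<bullet>c y = F (P *\<^sub>v g) w \<bullet>c y" .
    qed
    \<comment> \<open>Both functions are extensional, so agreement on \<open>\<Omega>\<close> is
      equality.\<close>
    moreover have "f \<in> extensional \<Omega>" "F (P *\<^sub>v g) \<in> extensional \<Omega>"
      using f H FH[OF Pg] by (auto simp: PiE_iff)
    ultimately have "f = F (P *\<^sub>v g)" by (auto intro: extensionalityI)
    with Pg show ?thesis by blast
  qed
  show ?thesis
  proof
    assume hilb: "hilbert_space ?V ip"
    show "\<forall>v \<in> carrier_vec n. v \<noteq> 0\<^sub>v n \<longrightarrow> 0 < Re ((P *\<^sub>v v) \<bullet>c v)"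
    proof (intro ballI impI)
      fix v :: "complex vec" assume v: "v \<in> carrier_vec n" "v \<noteq> 0\<^sub>v n"
      \<comment> \<open>At P v the form of \<open>Q\<close> takes the value of the form of
        \<open>P\<close> at v, up to conjugation, which the real part ignores. Also
        \<open>F ?u\<close> is \<open>E\<close> applied to \<open>v\<close>, so it is nonzero by
        separation.\<close>
      let ?u = "P *\<^sub>v v"
      have u: "?u \<in> carrier_vec n" using P(1) v by simp
      have "F ?u \<noteq> (\<lambda>z\<in>\<Omega>. 0\<^sub>v q)"
      proof
        assume "F ?u = (\<lambda>z\<in>\<Omega>. 0\<^sub>v q)"
        then have "F ?u w = 0\<^sub>v q" if "w \<in> S" for w using that fin by auto
        note Fw = this
        have "E w *\<^sub>v v = 0\<^sub>v q" if "w \<in> S" for w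
          using Fw[OF that] subsetD[OF fin(2) that] by (simp add: F_def QP[OF v(1)])
        with sep v show False by blast
      qed
      then have "0 < Re (ip (F ?u) (F ?u))"
        using hilb FH[OF u] by (simp add: hilbert_space_def)
      then show "0 < Re ((P *\<^sub>v v) \<bullet>c v)"
        unfolding ipF[OF u u] QP[OF v(1)] using cscalar_swap[OF v(1) u] by simp
    qed
  next
    assume pos: "\<forall>v \<in> carrier_vec n. v \<noteq> 0\<^sub>v n \<longrightarrow> 0 < Re ((P *\<^sub>v v) \<bullet>c v)"
    show "hilbert_space ?V ip"
    proof (rule pontryagin_positive_hilbert[OF pont])
      fix f assume "f \<in> carrier ?V" "f \<noteq> \<zero>\<^bsub>?V\<^esub>"
      then have f: "f \<in> H" "f \<noteq> (\<lambda>z\<in>\<Omega>. 0\<^sub>v q)" by auto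
      then obtain u where u: "u \<in> carrier_vec n" "f = F u" using surj by blast
      \<comment> \<open>The inverse substitution, which turns the form of \<open>Q\<close> at
        \<open>u\<close> into the form of \<open>P\<close> at \<open>?v\<close>.\<close>
      let ?v = "Q *\<^sub>v u"
      have Pv: "P *\<^sub>v ?v = u"
        using P u by (subst assoc_mult_mat_vec[symmetric, of _ n n _ n]) auto
      have "?v \<noteq> 0\<^sub>v n"
      proof
        assume z: "?v = 0\<^sub>v n"
        have "u = 0\<^sub>v n" using Pv P(1) unfolding z by (auto intro!: eq_vecI)
        with f(2) u F_zero show False by simp
      qed
      then have "0 < Re (u \<bullet>c ?v)" using pos Qv[OF u(1)] Pv by force
      then show "0 < Re (ip f f)"
        unfolding u(2) ipF[OF u(1) u(1)] using cscalar_swap[OF u(1) Qv[OF u(1)]] by simp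
    qed
  qed
qed

subsection \<open>Factorization of the kernel\<close>

text \<open>Side conditions on dimensions alone let the simplifier use these laws as rewrite rules,
  without guessing the size parameters of \<open>carrier_mat\<close>.\<close>

lemma mat_assoc_dim:
  "dim_col A = dim_row B \<Longrightarrow> dim_col B = dim_row C \<Longrightarrow> A * B * C = A * (B * C :: complex mat)"
  by (rule assoc_mult_mat[of A "dim_row A" "dim_col A" B "dim_col B" C "dim_col C"])
    (auto intro!: carrier_matI)

lemma mat_distrib_dim:
  fixes A B C :: "complex mat"
  shows "dim_row A = dim_row B \<Longrightarrow> dim_col A = dim_col B \<Longrightarrow> dim_col A = dim_row C \<Longrightarrow>
      (A + B) * C = A * C + B * C"
    "dim_row A = dim_row B \<Longrightarrow> dim_col A = dim_col B \<Longrightarrow> dim_col A = dim_row C \<Longrightarrow>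
      (A - B) * C = A * C - B * C"
    "dim_row B = dim_row C \<Longrightarrow> dim_col B = dim_col C \<Longrightarrow> dim_col A = dim_row B \<Longrightarrow>
      A * (B + C) = A * B + A * C"
    "dim_row B = dim_row C \<Longrightarrow> dim_col B = dim_col C \<Longrightarrow> dim_col A = dim_row B \<Longrightarrow>
      A * (B - C) = A * B - A * C"
    "dim_col A = dim_row B \<Longrightarrow> (c \<cdot>\<^sub>m A) * B = c \<cdot>\<^sub>m (A * B)"
    "dim_col A = dim_row B \<Longrightarrow> A * (c \<cdot>\<^sub>m B) = c \<cdot>\<^sub>m (A * B)"
    "dim_col A = dim_row B \<Longrightarrow> (- A) * B = - (A * B)"
    "dim_col A = dim_row B \<Longrightarrow> A * (- B) = - (A * B)"
  subgoal by (rule add_mult_distrib_mat[of A "dim_row B" "dim_col B" B C "dim_col C"]) (auto intro!: carrier_matI)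
  subgoal by (rule minus_mult_distrib_mat[of A "dim_row B" "dim_col B" B C "dim_col C"]) (auto intro!: carrier_matI)
  subgoal by (rule mult_add_distrib_mat[of A "dim_row A" "dim_row C" B "dim_col C" C]) (auto intro!: carrier_matI)
  subgoal by (rule mult_minus_distrib_mat[of A "dim_row A" "dim_row C" B "dim_col C" C]) (auto intro!: carrier_matI)
  subgoal by (rule mult_smult_assoc_mat[of A "dim_row A" "dim_row B" B "dim_col B"]) (auto intro!: carrier_matI)
  subgoal by (rule mult_smult_distrib[of A "dim_row A" "dim_row B" B "dim_col B"]) (auto intro!: carrier_matI)
  subgoal by simp
  subgoal by simp
  done

text \<open>Expanding \<open>J - \<Theta>(z) J \<Theta>(w)\<^sup>*\<close>, the Lyapunov equation turns the quadratic term into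
  \<open>-(C R(z)) (Q A\<^sup>* + A Q) (C R(w))\<^sup>*\<close>, which cancels against the linear terms up to \<open>z + cnj w\<close>.\<close>

lemma kernel_factorization:
  assumes C: "C \<in> carrier_mat q n" and A: "A \<in> carrier_mat n n"
    and P: "P \<in> carrier_mat n n" and Q: "Q \<in> carrier_mat n n" "P * Q = 1\<^sub>m n" "Q * P = 1\<^sub>m n" "mat_adjoint Q = Q"
    and J: "J \<in> carrier_mat q q" "J * J = 1\<^sub>m q" "mat_adjoint J = J"
    and lyap: "mat_adjoint C * (J * C) = - (P * A + mat_adjoint A * P)"
    and z: "z \<notin> spectrum A" and w: "w \<notin> spectrum A" and zw: "z + cnj w \<noteq> 0"
  defines "R \<equiv> \<lambda>z. minv (z \<cdot>\<^sub>m 1\<^sub>m n - A)"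
  defines "\<Theta> \<equiv> \<lambda>z. 1\<^sub>m q - C * R z * Q * mat_adjoint C * J"
  shows "(1 / (z + cnj w)) \<cdot>\<^sub>m (J - \<Theta> z * J * mat_adjoint (\<Theta> w)) =
    (C * R z) * Q * mat_adjoint (C * R w)"
proof -
  define a where "a = C * R z"
  define b where "b = mat_adjoint (C * R w)"
  define D where "D = mat_adjoint C"
  define A' where "A' = mat_adjoint A"
  have Rz: "R z \<in> carrier_mat n n" "R z * A = z \<cdot>\<^sub>m R z - 1\<^sub>m n"
    unfolding R_def using resolvent[OF A z] by auto
  have Rw: "R w \<in> carrier_mat n n" "R w * A = w \<cdot>\<^sub>m R w - 1\<^sub>m n"
    unfolding R_def using resolvent[OF A w] by auto
  have a: "a \<in> carrier_mat q n" using C Rz by (simp add: a_def)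
  have CRw: "C * R w \<in> carrier_mat q n" using C Rw by simp
  have b: "b \<in> carrier_mat n q" unfolding b_def using CRw by simp
  have D: "D \<in> carrier_mat n q" using C by (simp add: D_def)
  have A': "A' \<in> carrier_mat n n" using A by (simp add: A'_def)
  note dims = carrier_matD[OF a] carrier_matD[OF b] carrier_matD[OF C] carrier_matD[OF D] carrier_matD[OF A']
    carrier_matD[OF A] carrier_matD[OF P] carrier_matD[OF Q(1)] carrier_matD[OF J(1)]
    carrier_matD[OF Rz(1)] carrier_matD[OF Rw(1)]
  note [simp] = dims
  note ring = mat_assoc_dim mat_distrib_dim
  have "a * A = C * (R z * A)" unfolding a_def by (simp add: ring)
  also have "\<dots> = z \<cdot>\<^sub>m a - C" unfolding Rz(2) a_def using C by (simp add: ring)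
  finally have aA: "a * A = z \<cdot>\<^sub>m a - C" .
  have "C * R w * A = C * (R w * A)" by (simp add: ring)
  also have "\<dots> = w \<cdot>\<^sub>m (C * R w) - C" unfolding Rw(2) using C by (simp add: ring)
  finally have "mat_adjoint (C * R w * A) = mat_adjoint (w \<cdot>\<^sub>m (C * R w) - C)" by simp
  then have A'b: "A' * b = cnj w \<cdot>\<^sub>m b - D"
    using mat_adjoint_mult[OF CRw A] mat_adjoint_minus[of "w \<cdot>\<^sub>m (C * R w)" q n C] CRw C
    by (simp add: A'_def b_def D_def mat_adjoint_smult)
  \<comment> \<open>Solving the resolvent equations for \<open>C\<close> and \<open>D\<close> makes
    every term of the expansion start with \<open>a\<close> and end with \<open>b\<close>.\<close>
  have C_eq: "C = z \<cdot>\<^sub>m a - a * A"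
    using mat_diff_eqD[of "z \<cdot>\<^sub>m a" q n C] aA a C by simp
  have D_eq: "D = cnj w \<cdot>\<^sub>m b - A' * b"
    using mat_diff_eqD[of "cnj w \<cdot>\<^sub>m b" n q D] A'b b D by simp
  \<comment> \<open>\<open>T\<close> is the desired value; \<open>T1\<close> and \<open>T2\<close>
    are the terms with \<open>A\<close> and its adjoint. The linear parts contribute them
    negatively, and the quadratic part cancels them.\<close>
  define T where "T = a * (Q * b)"
  define T1 where "T1 = a * (A * (Q * b))"
  define T2 where "T2 = a * (Q * (A' * b))"
  have T: "T \<in> carrier_mat q q" "T1 \<in> carrier_mat q q" "T2 \<in> carrier_mat q q"
    by (auto simp: T_def T1_def T2_def intro!: carrier_matI)
  have e1: "C * (Q * b) = z \<cdot>\<^sub>m T - T1"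
  proof -
    have "C * (Q * b) = (z \<cdot>\<^sub>m a - a * A) * (Q * b)" using C_eq by simp
    then show ?thesis by (simp add: ring T_def T1_def)
  qed
  have e2: "a * (Q * D) = cnj w \<cdot>\<^sub>m T - T2"
  proof -
    have "a * (Q * D) = a * (Q * (cnj w \<cdot>\<^sub>m b - A' * b))" using D_eq by simp
    then show ?thesis by (simp add: ring T_def T2_def)
  qed
  have e3: "a * (Q * ((D * (J * C)) * (Q * b))) = - (T1 + T2)"
  proof -
    have "Q * ((P * A) * (Q * b)) = (Q * P) * (A * (Q * b))" by (simp add: ring)
    also have "\<dots> = A * (Q * b)" unfolding Q(3) by (simp add: left_mult_one_mat' )
    finally have 1: "Q * ((P * A) * (Q * b)) = A * (Q * b)" .
    have "(A' * P) * (Q * b) = A' * ((P * Q) * b)" by (simp add: ring)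
    also have "\<dots> = A' * b" unfolding Q(2) using b by simp
    finally have 2: "(A' * P) * (Q * b) = A' * b" .
    have "(D * (J * C)) * (Q * b) = - ((P * A) * (Q * b) + (A' * P) * (Q * b))"
      unfolding lyap[folded D_def A'_def] by (simp add: mat_distrib_dim)
    then have "a * (Q * ((D * (J * C)) * (Q * b))) =
        - (a * (Q * ((P * A) * (Q * b))) + a * (Q * ((A' * P) * (Q * b))))"
      by (simp add: mat_distrib_dim)
    then show ?thesis unfolding 1 2 T1_def T2_def .
  qed
  have Th: "\<Theta> z = 1\<^sub>m q - a * (Q * (D * J))"
    unfolding \<Theta>_def a_def D_def[symmetric] by (simp add: ring)
  have "mat_adjoint (C * R w * (Q * (D * J))) = J * (C * (Q * b))"
  proof -
    have "mat_adjoint (D * J) = J * C"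
      using mat_adjoint_mult[OF D J(1)] J(3) by (simp add: D_def)
    then have "mat_adjoint (Q * (D * J)) = J * C * Q"
      using mat_adjoint_mult[OF Q(1), of "D * J" q] D J(1) Q(4) by simp
    then have "mat_adjoint (C * R w * (Q * (D * J))) = J * C * Q * b"
      using mat_adjoint_mult[OF CRw, of "Q * (D * J)" q] D J(1) Q(1) by (simp add: b_def)
    then show ?thesis by (simp add: ring)
  qed
  then have Th': "mat_adjoint (\<Theta> w) = 1\<^sub>m q - J * (C * (Q * b))"
    unfolding \<Theta>_def D_def[symmetric]
    by (subst mat_adjoint_minus[of _ q q]) (auto simp: ring intro!: carrier_matI)
  have JJ: "J * (J * M) = M" if "dim_row M = q" for M
    using mat_assoc_dim[of J J M] that J(2) by (simp add: left_mult_one_mat')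
  have "\<Theta> z * J = J - a * (Q * D)"
    unfolding Th using J(2) D by (simp add: ring)
  then have "\<Theta> z * J * mat_adjoint (\<Theta> w) =
      (J - a * (Q * D)) - (C * (Q * b) - a * (Q * ((D * (J * C)) * (Q * b))))"
    unfolding Th' by (simp add: ring JJ right_mult_one_mat')
  also have "\<dots> = (J - (cnj w \<cdot>\<^sub>m T - T2)) - ((z \<cdot>\<^sub>m T - T1) + (T1 + T2))"
    unfolding e1 e2 e3 using T J by (intro eq_matI) auto
  finally have "J - \<Theta> z * J * mat_adjoint (\<Theta> w) = (z + cnj w) \<cdot>\<^sub>m T"
    using T J(1) by (intro eq_matI) (auto simp: algebra_simps)
  then have "(1 / (z + cnj w)) \<cdot>\<^sub>m (J - \<Theta> z * J * mat_adjoint (\<Theta> w)) = T"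
    using zw T by (intro eq_matI) auto
  then show ?thesis unfolding T_def a_def b_def by (simp add: ring)
qed

subsection \<open>Lyapunov equations and the Hautus test\<close>

lemma spectrum_adjoint_rhp:
  assumes "A \<in> carrier_mat n n" "spectrum A \<subseteq> right_half_plane"
  shows "spectrum (mat_adjoint A) \<subseteq> right_half_plane"
  using spectrum_adjoint[OF assms(1)] assms(2) by (force simp: right_half_plane_def)

text \<open>This is the Sylvester equation for \<open>T\<close> and \<open>- B\<close>, whose
  spectra lie in opposite open half planes.\<close>

lemma lyapunov_unique:
  assumes T: "T \<in> carrier_mat n n" "spectrum T \<subseteq> right_half_plane"
    and B: "B \<in> carrier_mat k k" "spectrum B \<subseteq> right_half_plane" and Q: "Q \<in> carrier_mat n k"
  shows "\<exists>!G. G \<in> carrier_mat n k \<and> G * B + T * G = Q"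
proof -
  have "spectrum T \<inter> spectrum (- B) = {}"
  proof (rule ccontr)
    assume "spectrum T \<inter> spectrum (- B) \<noteq> {}"
    then obtain e where e: "e \<in> spectrum T" "e \<in> spectrum (- B)" by auto
    then obtain v where v: "v \<in> carrier_vec k" "v \<noteq> 0\<^sub>v k" "- B *\<^sub>v v = e \<cdot>\<^sub>v v"
      using B by (auto simp: spectrum_iff[of "- B" k])
    then have "- (B *\<^sub>v v) = e \<cdot>\<^sub>v v" using B by (simp add: uminus_mult_mat_vec)
    then have "B *\<^sub>v v = - (e \<cdot>\<^sub>v v)" by (metis uminus_uminus_vec)
    also have "\<dots> = (- e) \<cdot>\<^sub>v v" by (intro eq_vecI) auto
    finally have "- e \<in> spectrum B" using v B by (auto simp: spectrum_iff[of B k])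
    with e T(2) B(2) show False by (fastforce simp: right_half_plane_def)
  qed
  from sylvester_unique[OF T(1) _ Q this]
  have "\<exists>!G. G \<in> carrier_mat n k \<and> T * G = G * - B + Q" using B by simp
  moreover have "T * G = G * - B + Q \<longleftrightarrow> G * B + T * G = Q" if G: "G \<in> carrier_mat n k" for G
  proof -
    have neg: "G * - B = - (G * B)" using G B by (simp add: mat_distrib_dim)
    have TG: "T * G \<in> carrier_mat n k" and GB: "G * B \<in> carrier_mat n k" using G B T by auto
    have cancel: "- M + (M + N) = N" "M + (- M + N) = N"
      if "M \<in> carrier_mat n k" "N \<in> carrier_mat n k" for M N :: "complex mat"
      using that by (auto intro!: eq_matI)
    have 1: "- (G * B) + (G * B + T * G) = T * G" and 2: "G * B + (- (G * B) + Q) = Q"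
      using cancel TG GB Q by blast+
    show ?thesis unfolding neg using 1 2 by metis
  qed
  ultimately show ?thesis by (metis (no_types, lifting))
qed

text \<open>Taking adjoints swaps the two terms on the left and fixes the right side, so the adjoint
  of \<open>G\<close> solves the same equation and uniqueness applies.\<close>

lemma lyapunov_hermitian:
  assumes T: "T \<in> carrier_mat n n" "spectrum T \<subseteq> right_half_plane"
    and Q: "Q \<in> carrier_mat n n" "mat_adjoint Q = Q"
    and G: "G \<in> carrier_mat n n" "G * T + mat_adjoint T * G = Q"
  shows "mat_adjoint G = G"
proof -
  have "mat_adjoint (G * T + mat_adjoint T * G) = mat_adjoint T * mat_adjoint G + mat_adjoint G * T"
    using G(1) T(1) mat_adjoint_mult[OF G(1) T(1)] mat_adjoint_mult[of "mat_adjoint T" n n G n]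
    by (subst mat_adjoint_add[of _ n n]) auto
  also have "\<dots> = mat_adjoint G * T + mat_adjoint T * mat_adjoint G"
    using G(1) T(1) by (intro comm_add_mat[of _ n n]) auto
  finally have "mat_adjoint G * T + mat_adjoint T * mat_adjoint G = Q" using G Q by simp
  then show ?thesis
    using lyapunov_unique[OF mat_adjoint_carrier[OF T(1)] spectrum_adjoint_rhp[OF T] T Q(1)] G mat_adjoint_carrier[OF G(1)]
    by blast
qed

text \<open>Such a \<open>v\<close> is orthogonal to every column of
  \<open>Z ^\<^sub>m k * X\<close>. Its orthogonal complement is a submodule that contains these
  spanning columns, so it contains \<open>v\<close> itself.\<close>

lemma controllable_hautus:
  assumes ctr: "controllable n Z X" and Z: "Z \<in> carrier_mat n n" and X: "X \<in> carrier_mat n p"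
    and v: "v \<in> carrier_vec n" "mat_adjoint Z *\<^sub>v v = e \<cdot>\<^sub>v v" "mat_adjoint X *\<^sub>v v = 0\<^sub>v p"
  shows "v = 0\<^sub>v n"
proof -
  have pow: "mat_adjoint (Z ^\<^sub>m k) *\<^sub>v v = e ^ k \<cdot>\<^sub>v v" for k
  proof (induction k)
    case 0
    show ?case using Z v by simp
  next
    case (Suc k)
    have Zk: "Z ^\<^sub>m k \<in> carrier_mat n n" using Z by simp
    have "mat_adjoint (Z ^\<^sub>m Suc k) *\<^sub>v v = mat_adjoint Z *\<^sub>v (mat_adjoint (Z ^\<^sub>m k) *\<^sub>v v)"
      using mat_adjoint_mult[OF Zk Z] Z Zk v by (simp add: assoc_mult_mat_vec[of _ n n _ n])
    also have "\<dots> = e ^ Suc k \<cdot>\<^sub>v v"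
      unfolding Suc using Z v by (simp add: mult_mat_vec[of _ n n] smult_smult_assoc mult.commute)
    finally show ?case .
  qed
  interpret vec_space "TYPE(complex)" n .
  let ?N = "{x \<in> carrier_vec n. x \<bullet>c v = 0}"
  have "(\<Union>k<n. set (cols (Z ^\<^sub>m k * X))) \<subseteq> ?N"
  proof
    fix c assume "c \<in> (\<Union>k<n. set (cols (Z ^\<^sub>m k * X)))"
    then obtain k j where j: "j < p" "c = col (Z ^\<^sub>m k * X) j"
      using X by (auto simp: cols_def)
    have Zk: "Z ^\<^sub>m k \<in> carrier_mat n n" using Z by simp
    have M: "Z ^\<^sub>m k * X \<in> carrier_mat n p" using Zk X by simp
    have c: "c = (Z ^\<^sub>m k * X) *\<^sub>v unit_vec p j" unfolding j(2) using M j(1)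
      by (intro eq_vecI) (auto simp: scalar_prod_right_unit simp del: index_mult_mat(1))
    have "mat_adjoint (Z ^\<^sub>m k * X) *\<^sub>v v = mat_adjoint X *\<^sub>v (mat_adjoint (Z ^\<^sub>m k) *\<^sub>v v)"
      using mat_adjoint_mult[OF Zk X] X Zk v by (simp add: assoc_mult_mat_vec[of _ p n _ n])
    also have "\<dots> = 0\<^sub>v p"
      unfolding pow using X v by (simp add: mult_mat_vec[of _ p n])
    finally have "c \<bullet>c v = 0"
      unfolding c cscalar_mat_adjoint[OF M unit_vec_carrier v(1)] using j(1) by simp
    moreover have "c \<in> carrier_vec n" unfolding c using M by (intro mult_mat_vec_carrier) auto
    ultimately show "c \<in> ?N" by simp
  qed
  moreover have "submodule class_ring ?N V"
    by (rule submodule.intro)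
      (use v(1) in \<open>auto simp: module_axioms add_scalar_prod_distrib[of _ n] class_ring_simps vec_module\<close>)
  ultimately have "carrier_vec n \<subseteq> ?N"
    using ctr span_is_subset[of "\<Union>k<n. set (cols (Z ^\<^sub>m k * X))" ?N] unfolding controllable_def by auto
  with v(1) have "v \<bullet>c v = 0" by blast
  then show ?thesis using cscalar_self(3)[OF v(1)] by simp
qed

text \<open>Powers of \<open>W\<close> only rescale an eigenvector, so a single application of
  \<open>U\<close> that gives zero makes all the observations zero.\<close>

lemma observable_hautus:
  assumes obs: "observable n U W" and W: "W \<in> carrier_mat n n" and U: "U \<in> carrier_mat m n"
    and v: "v \<in> carrier_vec n" "W *\<^sub>v v = e \<cdot>\<^sub>v v" "U *\<^sub>v v = 0\<^sub>v m"
  shows "v = 0\<^sub>v n"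
proof -
  have pow: "W ^\<^sub>m k *\<^sub>v v = e ^ k \<cdot>\<^sub>v v" for k
  proof (induction k)
    case 0
    show ?case using W v by simp
  next
    case (Suc k)
    have Wk: "W ^\<^sub>m k \<in> carrier_mat n n" using W by simp
    have "W ^\<^sub>m Suc k *\<^sub>v v = W ^\<^sub>m k *\<^sub>v (W *\<^sub>v v)"
      using assoc_mult_mat_vec[OF Wk W v(1)] by simp
    also have "\<dots> = e \<cdot>\<^sub>v (W ^\<^sub>m k *\<^sub>v v)"
      unfolding v(2) by (rule mult_mat_vec[OF Wk v(1)])
    finally show ?case unfolding Suc by (simp add: smult_smult_assoc)
  qed
  have "(U * W ^\<^sub>m k) *\<^sub>v v = 0\<^sub>v (dim_row U)" for k
  proof -
    have Wk: "W ^\<^sub>m k \<in> carrier_mat n n" using W by simp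
    have "(U * W ^\<^sub>m k) *\<^sub>v v = U *\<^sub>v (W ^\<^sub>m k *\<^sub>v v)"
      using U Wk v(1) by (intro assoc_mult_mat_vec)
    then show ?thesis unfolding pow using U v by (simp add: mult_mat_vec[of _ m n])
  qed
  with obs v(1) show ?thesis by (simp add: observable_def)
qed

subsection \<open>Interpolation data\<close>

lemma uminus_zero_mat [simp]: "- 0\<^sub>m k l = (0\<^sub>m k l :: complex mat)"
  by (intro eq_matI) auto

locale admissible_btoa =
  fixes nZ nW p m :: nat and D :: btoa_data
  assumes admissible: "btoa_admissible nZ nW p m D"
begin

lemma carriers:
  "dZ D \<in> carrier_mat nZ nZ" "dX D \<in> carrier_mat nZ p" "dY D \<in> carrier_mat nZ m"
  "dW D \<in> carrier_mat nW nW" "dU D \<in> carrier_mat m nW" "dV D \<in> carrier_mat p nW"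
  "dGamma D \<in> carrier_mat nZ nW"
  using admissible by (auto simp: btoa_admissible_def)

lemmas dims [simp] = carriers[THEN carrier_matD(1)] carriers[THEN carrier_matD(2)]

lemma spectra:
  "spectrum (dZ D) \<subseteq> right_half_plane" "spectrum (dW D) \<subseteq> right_half_plane"
  using admissible by (auto simp: btoa_admissible_def)

text \<open>\<open>lyapunov_unique\<close> with \<open>Z\<close> and its adjoint as coefficients
  makes the definite description denote a solution.\<close>

lemma Gamma_L:
  "btoa_Gamma_L D \<in> carrier_mat nZ nZ"
  "btoa_Gamma_L D * mat_adjoint (dZ D) + dZ D * btoa_Gamma_L D =
    dX D * mat_adjoint (dX D) - dY D * mat_adjoint (dY D)"
proof -
  let ?Q = "dX D * mat_adjoint (dX D) - dY D * mat_adjoint (dY D)"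
  have "?Q \<in> carrier_mat nZ nZ" by (auto intro!: carrier_matI)
  note ex = lyapunov_unique[OF carriers(1) spectra(1) mat_adjoint_carrier[OF carriers(1)]
      spectrum_adjoint_rhp[OF carriers(1) spectra(1)] this]
  show "btoa_Gamma_L D \<in> carrier_mat nZ nZ"
    "btoa_Gamma_L D * mat_adjoint (dZ D) + dZ D * btoa_Gamma_L D = ?Q"
    using theI'[OF ex] by (simp_all add: btoa_Gamma_L_def)
qed

lemma Gamma_R:
  "btoa_Gamma_R D \<in> carrier_mat nW nW"
  "btoa_Gamma_R D * dW D + mat_adjoint (dW D) * btoa_Gamma_R D =
    mat_adjoint (dU D) * dU D - mat_adjoint (dV D) * dV D"
proof -
  let ?Q = "mat_adjoint (dU D) * dU D - mat_adjoint (dV D) * dV D"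
  have "?Q \<in> carrier_mat nW nW" by (auto intro!: carrier_matI)
  note ex = lyapunov_unique[OF mat_adjoint_carrier[OF carriers(4)]
      spectrum_adjoint_rhp[OF carriers(4) spectra(2)] carriers(4) spectra(2) this]
  show "btoa_Gamma_R D \<in> carrier_mat nW nW"
    "btoa_Gamma_R D * dW D + mat_adjoint (dW D) * btoa_Gamma_R D = ?Q"
    using theI'[OF ex] by (simp_all add: btoa_Gamma_R_def)
qed

lemma Gamma_L_hermitian: "mat_adjoint (btoa_Gamma_L D) = btoa_Gamma_L D"
proof (rule lyapunov_hermitian[OF mat_adjoint_carrier[OF carriers(1)]
      spectrum_adjoint_rhp[OF carriers(1) spectra(1)] _ _ Gamma_L(1)])
  let ?Q = "dX D * mat_adjoint (dX D) - dY D * mat_adjoint (dY D)"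
  show "?Q \<in> carrier_mat nZ nZ" by (auto intro!: carrier_matI)
  show "mat_adjoint ?Q = ?Q"
    using mat_adjoint_mult[OF carriers(2) mat_adjoint_carrier[OF carriers(2)]]
      mat_adjoint_mult[OF carriers(3) mat_adjoint_carrier[OF carriers(3)]]
    by (subst mat_adjoint_minus[of _ nZ nZ]) (auto intro!: carrier_matI)
qed (use Gamma_L(2) in simp)

lemma Gamma_R_hermitian: "mat_adjoint (btoa_Gamma_R D) = btoa_Gamma_R D"
proof (rule lyapunov_hermitian[OF carriers(4) spectra(2) _ _ Gamma_R])
  let ?Q = "mat_adjoint (dU D) * dU D - mat_adjoint (dV D) * dV D"
  show "?Q \<in> carrier_mat nW nW" by (auto intro!: carrier_matI)
  show "mat_adjoint ?Q = ?Q"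
    using mat_adjoint_mult[OF mat_adjoint_carrier[OF carriers(5)] carriers(5)]
      mat_adjoint_mult[OF mat_adjoint_carrier[OF carriers(6)] carriers(6)]
    by (subst mat_adjoint_minus[of _ nW nW]) (auto intro!: carrier_matI)
qed

lemma Pick_carrier: "btoa_Pick D \<in> carrier_mat (nZ + nW) (nZ + nW)"
  using Gamma_L(1) Gamma_R(1) by (simp add: btoa_Pick_def)

lemma Pick_hermitian: "mat_adjoint (btoa_Pick D) = btoa_Pick D"
  unfolding btoa_Pick_def
  by (subst mat_adjoint_four_block[OF Gamma_L(1) carriers(7) mat_adjoint_carrier[OF carriers(7)] Gamma_R(1)])
    (simp add: Gamma_L_hermitian Gamma_R_hermitian)

lemma A_carrier: "btoa_A D \<in> carrier_mat (nZ + nW) (nZ + nW)"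
  using carriers by (auto simp: btoa_A_def Let_def)

lemma C_carrier: "btoa_C D \<in> carrier_mat (p + m) (nZ + nW)"
  using carriers by (auto simp: btoa_C_def)

lemma J:
  "btoa_J D \<in> carrier_mat (p + m) (p + m)" "btoa_J D * btoa_J D = 1\<^sub>m (p + m)"
  "mat_adjoint (btoa_J D) = btoa_J D"
proof -
  have J: "btoa_J D = four_block_mat (1\<^sub>m p) (0\<^sub>m p m) (0\<^sub>m m p) (- 1\<^sub>m m)"
    by (simp add: btoa_J_def Let_def)
  show "btoa_J D \<in> carrier_mat (p + m) (p + m)" unfolding J by auto
  show "mat_adjoint (btoa_J D) = btoa_J D" unfolding J
    by (subst mat_adjoint_four_block[of _ p p _ m _ m]) (auto simp: mat_adjoint_uminus)
  have "btoa_J D * btoa_J D = four_block_mat (1\<^sub>m p) (0\<^sub>m p m) (0\<^sub>m m p) (1\<^sub>m m)" unfolding J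
    by (subst mult_four_block_mat[of _ p p _ m _ m _ _ p _ m]) (auto simp: uminus_zero_mat)
  then show "btoa_J D * btoa_J D = 1\<^sub>m (p + m)" by simp
qed

text \<open>Compare blocks: the diagonal ones are the two Lyapunov equations, the off-diagonal ones
  the coupling equation and its adjoint. The minus signs in the first block columns of
  \<open>btoa_A\<close> and \<open>btoa_C\<close> make all four fit one equation.\<close>

lemma Pick_lyapunov:
  "mat_adjoint (btoa_C D) * (btoa_J D * btoa_C D) =
    - (btoa_Pick D * btoa_A D + mat_adjoint (btoa_A D) * btoa_Pick D)"
proof -
  let ?Z = "dZ D" and ?X = "dX D" and ?Y = "dY D" and ?U = "dU D" and ?V = "dV D" and ?W = "dW D"
    and ?G = "dGamma D" and ?L = "btoa_Gamma_L D" and ?R = "btoa_Gamma_R D"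
  note c = carriers carriers[THEN mat_adjoint_carrier] Gamma_L(1) Gamma_R(1)
  note [simp] = carrier_matD[OF Gamma_L(1)] carrier_matD[OF Gamma_R(1)]
  have A': "mat_adjoint (btoa_A D) = four_block_mat (- ?Z) (0\<^sub>m nZ nW) (0\<^sub>m nW nZ) (mat_adjoint ?W)"
    unfolding btoa_A_def Let_def using c
    by (subst mat_adjoint_four_block[of _ nZ nZ _ nW _ nW]) (auto simp: mat_adjoint_uminus)
  have C': "mat_adjoint (btoa_C D) = four_block_mat (- ?X) (- ?Y) (mat_adjoint ?V) (mat_adjoint ?U)"
    unfolding btoa_C_def using c
    by (subst mat_adjoint_four_block[of _ p nZ _ nW _ m]) (auto simp: mat_adjoint_uminus)
  have "btoa_J D * btoa_C D = four_block_mat (- mat_adjoint ?X) ?V (mat_adjoint ?Y) (- ?U)"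
  proof -
    have cX: "- mat_adjoint ?X \<in> carrier_mat p nZ" "- mat_adjoint ?Y \<in> carrier_mat m nZ" using c by auto
    have o: "- 1\<^sub>m m \<in> carrier_mat m m" by auto
    have e: "1\<^sub>m p * - mat_adjoint ?X + 0\<^sub>m p m * - mat_adjoint ?Y = - mat_adjoint ?X"
      "1\<^sub>m p * ?V + 0\<^sub>m p m * ?U = ?V"
      using cX c by simp_all
    have neg: "- 1\<^sub>m m * M = - M" if "M \<in> carrier_mat m k" for M :: "complex mat" and k
      using that by simp
    have nn: "- (- M) = M" for M :: "complex mat" by (intro eq_matI) auto
    have e': "0\<^sub>m m p * - mat_adjoint ?X + - 1\<^sub>m m * - mat_adjoint ?Y = mat_adjoint ?Y"
      "0\<^sub>m m p * ?V + - 1\<^sub>m m * ?U = - ?U"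
      unfolding neg[OF cX(2)] neg[OF carriers(5)] nn using cX c by simp_all
    show ?thesis
      unfolding btoa_C_def btoa_J_def Let_def dims
      unfolding mult_four_block_mat[OF one_carrier_mat zero_carrier_mat zero_carrier_mat o cX(1) carriers(6) cX(2) carriers(5)]
        e e' ..
  qed
  note JC = this
  have lhs: "mat_adjoint (btoa_C D) * (btoa_J D * btoa_C D) = four_block_mat
      (?X * mat_adjoint ?X - ?Y * mat_adjoint ?Y) (- (?X * ?V) + ?Y * ?U)
      (- (mat_adjoint ?V * mat_adjoint ?X) + mat_adjoint ?U * mat_adjoint ?Y)
      (mat_adjoint ?V * ?V - mat_adjoint ?U * ?U)"
  proof -
    have cX: "- ?X \<in> carrier_mat nZ p" "- ?Y \<in> carrier_mat nZ m" "- mat_adjoint ?X \<in> carrier_mat p nZ"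
      "- ?U \<in> carrier_mat m nW" using c by auto
    have e: "- ?X * - mat_adjoint ?X + - ?Y * mat_adjoint ?Y = ?X * mat_adjoint ?X - ?Y * mat_adjoint ?Y"
      "- ?X * ?V + - ?Y * - ?U = - (?X * ?V) + ?Y * ?U"
      "mat_adjoint ?V * - mat_adjoint ?X + mat_adjoint ?U * mat_adjoint ?Y =
        - (mat_adjoint ?V * mat_adjoint ?X) + mat_adjoint ?U * mat_adjoint ?Y"
      "mat_adjoint ?V * ?V + mat_adjoint ?U * - ?U = mat_adjoint ?V * ?V - mat_adjoint ?U * ?U"
      by (auto simp: mat_distrib_dim(7,8) intro!: eq_matI simp del: index_mult_mat(1))
    show ?thesis unfolding C' JC
      unfolding mult_four_block_mat[OF cX(1,2) c(13,12) cX(3) c(6,10) cX(4)] e ..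
  qed
  have PA: "btoa_Pick D * btoa_A D = four_block_mat
      (- (?L * mat_adjoint ?Z)) (?G * ?W) (- (mat_adjoint ?G * mat_adjoint ?Z)) (?R * ?W)"
  proof -
    have cZ: "- mat_adjoint ?Z \<in> carrier_mat nZ nZ" using c by auto
    have e: "?L * - mat_adjoint ?Z + ?G * 0\<^sub>m nW nZ = - (?L * mat_adjoint ?Z)"
      "?L * 0\<^sub>m nZ nW + ?G * ?W = ?G * ?W"
      "mat_adjoint ?G * - mat_adjoint ?Z + ?R * 0\<^sub>m nW nZ = - (mat_adjoint ?G * mat_adjoint ?Z)"
      "mat_adjoint ?G * 0\<^sub>m nZ nW + ?R * ?W = ?R * ?W"
      using c by (auto simp: mat_distrib_dim(8) right_mult_zero_mat[of _ nZ nW] right_mult_zero_mat[of _ nZ nZ]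
        right_mult_zero_mat[of _ nW nZ] right_mult_zero_mat[of _ nW nW] intro!: eq_matI simp del: index_mult_mat(1))
    show ?thesis unfolding btoa_A_def btoa_Pick_def Let_def dims
      unfolding mult_four_block_mat[OF Gamma_L(1) c(7,14) Gamma_R(1) cZ zero_carrier_mat zero_carrier_mat c(4)] e ..
  qed
  have AP: "mat_adjoint (btoa_A D) * btoa_Pick D = four_block_mat
      (- (?Z * ?L)) (- (?Z * ?G)) (mat_adjoint ?W * mat_adjoint ?G) (mat_adjoint ?W * ?R)"
  proof -
    have cZ: "- ?Z \<in> carrier_mat nZ nZ" using c by auto
    have e: "- ?Z * ?L + 0\<^sub>m nZ nW * mat_adjoint ?G = - (?Z * ?L)"
      "- ?Z * ?G + 0\<^sub>m nZ nW * ?R = - (?Z * ?G)"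
      "0\<^sub>m nW nZ * ?L + mat_adjoint ?W * mat_adjoint ?G = mat_adjoint ?W * mat_adjoint ?G"
      "0\<^sub>m nW nZ * ?G + mat_adjoint ?W * ?R = mat_adjoint ?W * ?R"
      using c by (auto simp: mat_distrib_dim(7) left_mult_zero_mat[of _ nZ nW] left_mult_zero_mat[of _ nZ nZ]
        left_mult_zero_mat[of _ nW nZ] left_mult_zero_mat[of _ nW nW] intro!: eq_matI simp del: index_mult_mat(1))
    show ?thesis unfolding A' btoa_Pick_def
      unfolding mult_four_block_mat[OF cZ zero_carrier_mat zero_carrier_mat c(11) Gamma_L(1) c(7,14) Gamma_R(1)] e ..
  qed
  have gamma: "?G * ?W - ?Z * ?G = ?X * ?V - ?Y * ?U"
    using admissible by (simp add: btoa_admissible_def)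
  \<comment> \<open>The adjoint of the coupling equation serves the lower left block.\<close>
  have gamma': "mat_adjoint ?W * mat_adjoint ?G - mat_adjoint ?G * mat_adjoint ?Z =
      mat_adjoint ?V * mat_adjoint ?X - mat_adjoint ?U * mat_adjoint ?Y"
  proof -
    have "mat_adjoint (?G * ?W - ?Z * ?G) = mat_adjoint (?X * ?V - ?Y * ?U)"
      using gamma by simp
    moreover have "mat_adjoint (?G * ?W - ?Z * ?G) =
        mat_adjoint ?W * mat_adjoint ?G - mat_adjoint ?G * mat_adjoint ?Z"
      using mat_adjoint_mult[OF carriers(7,4)] mat_adjoint_mult[OF carriers(1,7)]
      by (subst mat_adjoint_minus[of _ nZ nW]) (auto intro!: carrier_matI)
    moreover have "mat_adjoint (?X * ?V - ?Y * ?U) =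
        mat_adjoint ?V * mat_adjoint ?X - mat_adjoint ?U * mat_adjoint ?Y"
      using mat_adjoint_mult[OF carriers(2,6)] mat_adjoint_mult[OF carriers(3,5)]
      by (subst mat_adjoint_minus[of _ nZ nW]) (auto intro!: carrier_matI)
    ultimately show ?thesis by simp
  qed
  have 1: "?X * mat_adjoint ?X - ?Y * mat_adjoint ?Y = - (- (?L * mat_adjoint ?Z) + - (?Z * ?L))"
    unfolding Gamma_L(2)[symmetric]
    by (intro eq_matI) (auto simp del: index_mult_mat(1))
  have 2: "- (?X * ?V) + ?Y * ?U = - (?G * ?W + - (?Z * ?G))"
  proof (intro eq_matI)
    fix i j assume "i < dim_row (- (?G * ?W + - (?Z * ?G)))" "j < dim_col (- (?G * ?W + - (?Z * ?G)))"
    then show "(- (?X * ?V) + ?Y * ?U) $$ (i, j) = (- (?G * ?W + - (?Z * ?G))) $$ (i, j)"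
      using arg_cong[OF gamma, of "\<lambda>M. M $$ (i, j)"] by (simp del: index_mult_mat(1) add: algebra_simps)
  qed auto
  have 3: "- (mat_adjoint ?V * mat_adjoint ?X) + mat_adjoint ?U * mat_adjoint ?Y =
      - (- (mat_adjoint ?G * mat_adjoint ?Z) + mat_adjoint ?W * mat_adjoint ?G)"
    (is "_ = ?rhs")
  proof (intro eq_matI)
    fix i j assume "i < dim_row ?rhs" "j < dim_col ?rhs"
    then show "(- (mat_adjoint ?V * mat_adjoint ?X) + mat_adjoint ?U * mat_adjoint ?Y) $$ (i, j) = ?rhs $$ (i, j)"
      using arg_cong[OF gamma', of "\<lambda>M. M $$ (i, j)"] by (simp del: index_mult_mat(1) add: algebra_simps)
  qed auto
  have 4: "mat_adjoint ?V * ?V - mat_adjoint ?U * ?U = - (?R * ?W + mat_adjoint ?W * ?R)"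
    unfolding Gamma_R(2) by (intro eq_matI) (auto simp del: index_mult_mat(1))
  have uminus: "- four_block_mat A B C E = four_block_mat (- A) (- B) (- C) (- E)"
    if "A \<in> carrier_mat nZ nZ" "B \<in> carrier_mat nZ nW" "C \<in> carrier_mat nW nZ" "E \<in> carrier_mat nW nW"
    for A B C E :: "complex mat"
    using that by (intro eq_matI) auto
  show ?thesis unfolding lhs PA AP 1 2 3 4
    by (subst add_four_block_mat[of _ nZ nZ _ nW _ nW], (auto intro!: carrier_matI)[8],
        subst uminus) (auto intro!: carrier_matI)
qed

text \<open>Since \<open>btoa_A D\<close> is block diagonal, an eigenvector splits into
  \<open>a\<close> and \<open>b\<close>. A nonzero \<open>a\<close> gives the adjoint of
  \<open>Z\<close> the eigenvalue \<open>- e\<close>, so \<open>Re e < 0\<close>; a nonzero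
  \<open>b\<close> puts \<open>e\<close> into the spectrum of \<open>W\<close>. Neither happens on
  the domain, and both cannot happen at once. In the kernel of \<open>btoa_C D\<close>,
  controllability excludes \<open>a\<close> alone and observability excludes \<open>b\<close>
  alone.\<close>

lemma domain_disjoint: "btoa_domain D \<inter> spectrum (btoa_A D) = {}"
  and hautus: "v \<in> carrier_vec (nZ + nW) \<Longrightarrow> btoa_A D *\<^sub>v v = e \<cdot>\<^sub>v v \<Longrightarrow>
    btoa_C D *\<^sub>v v = 0\<^sub>v (p + m) \<Longrightarrow> v = 0\<^sub>v (nZ + nW)"
proof -
  have split: "mat_adjoint (dZ D) *\<^sub>v a = (- e) \<cdot>\<^sub>v a \<and> dW D *\<^sub>v b = e \<cdot>\<^sub>v b"
    if ab: "a \<in> carrier_vec nZ" "b \<in> carrier_vec nW" and ev: "btoa_A D *\<^sub>v (a @\<^sub>v b) = e \<cdot>\<^sub>v (a @\<^sub>v b)"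
    for a b e
  proof -
    have "btoa_A D *\<^sub>v (a @\<^sub>v b) = - (mat_adjoint (dZ D) *\<^sub>v a) @\<^sub>v (dW D *\<^sub>v b)"
    proof -
      have cZ: "- mat_adjoint (dZ D) \<in> carrier_mat nZ nZ" using carriers by simp
      have e: "- mat_adjoint (dZ D) *\<^sub>v a = - (mat_adjoint (dZ D) *\<^sub>v a)"
        using ab carriers by (intro uminus_mult_mat_vec) auto
      have "mat_adjoint (dZ D) *\<^sub>v a \<in> carrier_vec nZ"
        using ab by (intro mult_mat_vec_carrier[OF mat_adjoint_carrier[OF carriers(1)]])
      then have e': "- (mat_adjoint (dZ D) *\<^sub>v a) + 0\<^sub>v nZ = - (mat_adjoint (dZ D) *\<^sub>v a)"
        by (intro right_zero_vec) simp
      have "dW D *\<^sub>v b \<in> carrier_vec nW" using ab by (intro mult_mat_vec_carrier[OF carriers(4)])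
      then have e'': "0\<^sub>v nW + dW D *\<^sub>v b = dW D *\<^sub>v b" by (rule left_zero_vec)
      show ?thesis
        unfolding btoa_A_def Let_def dims
        unfolding four_block_mat_mult_vec[OF cZ zero_carrier_mat zero_carrier_mat carriers(4) ab(1,2)]
          zero_mat_mult_vec[OF ab(1)] zero_mat_mult_vec[OF ab(2)] e e' e'' ..
    qed
    moreover have "e \<cdot>\<^sub>v (a @\<^sub>v b) = (e \<cdot>\<^sub>v a) @\<^sub>v (e \<cdot>\<^sub>v b)"
      using ab by (intro eq_vecI) auto
    ultimately have eq: "- (mat_adjoint (dZ D) *\<^sub>v a) @\<^sub>v (dW D *\<^sub>v b) = (e \<cdot>\<^sub>v a) @\<^sub>v (e \<cdot>\<^sub>v b)"
      using ev by metis
    have "- (mat_adjoint (dZ D) *\<^sub>v a) \<in> carrier_vec nZ"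
      using mult_mat_vec_carrier[OF mat_adjoint_carrier[OF carriers(1)] ab(1)] by (rule uminus_carrier_vec[THEN iffD2])
    moreover have "e \<cdot>\<^sub>v a \<in> carrier_vec nZ" using ab(1) by (rule smult_carrier_vec[THEN iffD2])
    ultimately have "- (mat_adjoint (dZ D) *\<^sub>v a) = e \<cdot>\<^sub>v a" "dW D *\<^sub>v b = e \<cdot>\<^sub>v b"
      using append_vec_eq[THEN iffD1, OF _ _ eq] by blast+
    moreover from this(1) have "mat_adjoint (dZ D) *\<^sub>v a = - (e \<cdot>\<^sub>v a)" by (metis uminus_uminus_vec)
    moreover have "- (e \<cdot>\<^sub>v a) = (- e) \<cdot>\<^sub>v a" by (intro eq_vecI) auto
    ultimately show ?thesis by simp
  qed
  have neg: "Re e < 0" if "a \<in> carrier_vec nZ" "a \<noteq> 0\<^sub>v nZ" "mat_adjoint (dZ D) *\<^sub>v a = (- e) \<cdot>\<^sub>v a" for a e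
  proof -
    have "- e \<in> spectrum (mat_adjoint (dZ D))"
      using that by (auto simp: spectrum_iff[OF mat_adjoint_carrier[OF carriers(1)]])
    then have "- e \<in> right_half_plane" using spectrum_adjoint_rhp[OF carriers(1) spectra(1)] by blast
    then show ?thesis by (simp add: right_half_plane_def)
  qed
  have inW: "e \<in> spectrum (dW D)" if "b \<in> carrier_vec nW" "b \<noteq> 0\<^sub>v nW" "dW D *\<^sub>v b = e \<cdot>\<^sub>v b" for b e
    using that by (auto simp: spectrum_iff[OF carriers(4)])
  have zero: "0\<^sub>v nZ @\<^sub>v 0\<^sub>v nW = (0\<^sub>v (nZ + nW) :: complex vec)" by (intro eq_vecI) auto
  show "btoa_domain D \<inter> spectrum (btoa_A D) = {}"
  proof (rule ccontr)
    assume "btoa_domain D \<inter> spectrum (btoa_A D) \<noteq> {}"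
    then obtain e v where e: "e \<in> btoa_domain D" and v: "v \<in> carrier_vec (nZ + nW)" "v \<noteq> 0\<^sub>v (nZ + nW)"
      "btoa_A D *\<^sub>v v = e \<cdot>\<^sub>v v"
      by (auto simp: spectrum_iff[OF A_carrier])
    obtain a b where ab: "a \<in> carrier_vec nZ" "b \<in> carrier_vec nW" "v = a @\<^sub>v b"
      using vec_first_last_append[OF v(1)] by (metis vec_first_carrier vec_last_carrier)
    have "a \<noteq> 0\<^sub>v nZ \<or> b \<noteq> 0\<^sub>v nW" using v(2) ab zero by auto
    moreover note ev = split[OF ab(1,2) v(3)[unfolded ab(3)]]
    ultimately have "Re e < 0 \<or> e \<in> spectrum (dW D)"
      using neg[OF ab(1) _ conjunct1[OF ev]] inW[OF ab(2) _ conjunct2[OF ev]] by blast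
    with e show False by (auto simp: btoa_domain_def right_half_plane_def)
  qed
  assume v: "v \<in> carrier_vec (nZ + nW)" "btoa_A D *\<^sub>v v = e \<cdot>\<^sub>v v" "btoa_C D *\<^sub>v v = 0\<^sub>v (p + m)"
  obtain a b where ab: "a \<in> carrier_vec nZ" "b \<in> carrier_vec nW" "v = a @\<^sub>v b"
    using vec_first_last_append[OF v(1)] by (metis vec_first_carrier vec_last_carrier)
  note ev = split[OF ab(1,2) v(2)[unfolded ab(3)]]
  have Cv: "btoa_C D *\<^sub>v v = (- (mat_adjoint (dX D) *\<^sub>v a) + dV D *\<^sub>v b) @\<^sub>v
      (- (mat_adjoint (dY D) *\<^sub>v a) + dU D *\<^sub>v b)"
  proof -
    have cX: "- mat_adjoint (dX D) \<in> carrier_mat p nZ" "- mat_adjoint (dY D) \<in> carrier_mat m nZ"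
      using carriers by simp_all
    have e: "- mat_adjoint (dX D) *\<^sub>v a = - (mat_adjoint (dX D) *\<^sub>v a)"
      "- mat_adjoint (dY D) *\<^sub>v a = - (mat_adjoint (dY D) *\<^sub>v a)"
      using ab carriers by (auto intro!: uminus_mult_mat_vec)
    show ?thesis
      unfolding btoa_C_def ab(3)
      unfolding four_block_mat_mult_vec[OF cX(1) carriers(6) cX(2) carriers(5) ab(1,2)] e ..
  qed
  have zero': "0\<^sub>v (p + m) = 0\<^sub>v p @\<^sub>v (0\<^sub>v m :: complex vec)" by (intro eq_vecI) auto
  have C0: "- (mat_adjoint (dX D) *\<^sub>v a) + dV D *\<^sub>v b \<in> carrier_vec p"
    by (intro carrier_vecI) simp
  have C1: "- (mat_adjoint (dX D) *\<^sub>v a) + dV D *\<^sub>v b = 0\<^sub>v p"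
    and C2: "- (mat_adjoint (dY D) *\<^sub>v a) + dU D *\<^sub>v b = 0\<^sub>v m"
    using append_vec_eq[OF C0 zero_carrier_vec, THEN iffD1, OF v(3)[unfolded Cv zero']] by blast+
  \<comment> \<open>With one half zero, the other is tested by a single block row: \<open>U\<close>
    from the lower row for \<open>b\<close>, the adjoint of \<open>X\<close> from the upper row for
    \<open>a\<close>.\<close>
  have b: "b = 0\<^sub>v nW" if a: "a = 0\<^sub>v nZ"
  proof (rule observable_hautus[OF _ carriers(4,5) ab(2)])
    show "observable nW (dU D) (dW D)" using admissible by (simp add: btoa_admissible_def)
    show "dW D *\<^sub>v b = e \<cdot>\<^sub>v b" using ev by simp
    have "- (mat_adjoint (dY D) *\<^sub>v a) = 0\<^sub>v m" unfolding a using carriers by (intro eq_vecI) auto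
    then show "dU D *\<^sub>v b = 0\<^sub>v m" using C2 ab carriers by simp
  qed
  have a: "a = 0\<^sub>v nZ" if b: "b = 0\<^sub>v nW"
  proof (rule controllable_hautus[OF _ carriers(1,2) ab(1)])
    show "controllable nZ (dZ D) (dX D)" using admissible by (simp add: btoa_admissible_def)
    show "mat_adjoint (dZ D) *\<^sub>v a = (- e) \<cdot>\<^sub>v a" using ev by simp
    have "dV D *\<^sub>v b = 0\<^sub>v p" unfolding b using carriers by (intro eq_vecI) auto
    moreover have "- (mat_adjoint (dX D) *\<^sub>v a) + 0\<^sub>v p = - (mat_adjoint (dX D) *\<^sub>v a)"
      by (intro right_zero_vec carrier_vecI) simp
    ultimately have "- (mat_adjoint (dX D) *\<^sub>v a) = 0\<^sub>v p" using C1 by simp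
    then show "mat_adjoint (dX D) *\<^sub>v a = 0\<^sub>v p" by (metis uminus_uminus_vec uminus_zero_vec)
  qed
  have "a = 0\<^sub>v nZ \<or> b = 0\<^sub>v nW"
  proof (rule ccontr)
    assume "\<not> ?thesis"
    then have "Re e < 0" "e \<in> spectrum (dW D)" 
      using neg[OF ab(1) _ conjunct1[OF ev]] inW[OF ab(2) _ conjunct2[OF ev]] by blast+
    then show False using spectra(2) by (auto simp: right_half_plane_def)
  qed
  with a b have "a = 0\<^sub>v nZ" "b = 0\<^sub>v nW" by auto
  with ab(3) zero show "v = 0\<^sub>v (nZ + nW)" by simp
qed

text \<open>Removing the finite spectrum of \<open>W\<close> leaves as many sample points as
  \<open>hautus_separating\<close> asks for.\<close>

lemma domain_infinite: "infinite (btoa_domain D)"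
proof -
  have "range (\<lambda>k. complex_of_real (1 + real k)) \<subseteq> right_half_plane"
    by (auto simp: right_half_plane_def)
  moreover have "infinite (range (\<lambda>k. complex_of_real (1 + real k)))"
    by (intro range_inj_infinite) (auto simp: inj_def)
  ultimately have "infinite right_half_plane" using finite_subset by blast
  then show ?thesis
    unfolding btoa_domain_def using card_finite_spectrum(1)[OF carriers(4)] by simp
qed

lemma kernel_eq:
  assumes inv: "invertible_mat (btoa_Pick D)" and z: "z \<in> btoa_domain D" and w: "w \<in> btoa_domain D"
  defines "E \<equiv> \<lambda>z. btoa_C D * minv (z \<cdot>\<^sub>m 1\<^sub>m (nZ + nW) - btoa_A D)"
  shows "btoa_kernel D z w = E z * minv (btoa_Pick D) * mat_adjoint (E w)"
proof -
  \<comment> \<open>Both points have positive real part, so the denominator of the kernel is a true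
    nonzero number and not the default division by zero.\<close>
  have "0 < Re (z + cnj w)" using z w by (simp add: btoa_domain_def right_half_plane_def)
  then have "z + cnj w \<noteq> 0" by (metis less_irrefl zero_complex.sel(1))
  moreover have "z \<notin> spectrum (btoa_A D)" "w \<notin> spectrum (btoa_A D)"
    using z w domain_disjoint by auto
  ultimately show ?thesis
    using kernel_factorization[OF C_carrier A_carrier Pick_carrier minv_invertible[OF Pick_carrier inv]
        minv_hermitian[OF Pick_carrier inv Pick_hermitian] J Pick_lyapunov, of z w]
    by (simp add: btoa_kernel_def btoa_Theta_def Let_def E_def)
qed

end

theorem theorem2p3:
  fixes nZ nW p m :: nat
    and D :: btoa_data
    and H :: "(complex \<Rightarrow> complex vec) set"
    and ip :: "(complex \<Rightarrow> complex vec) \<Rightarrow> (complex \<Rightarrow> complex vec) \<Rightarrow> complex"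
  assumes "btoa_admissible nZ nW p m D"
    and "invertible_mat (btoa_Pick D)"
    and "reproducing_kernel_pontryagin_space (p + m) (btoa_domain D) (btoa_kernel D) H ip"
  shows "hilbert_space (fun_space (p + m) (btoa_domain D) H) ip \<longleftrightarrow>
         positive_definite (btoa_Pick D)"
proof -
  interpret admissible_btoa nZ nW p m D by unfold_locales (rule assms(1))
  let ?n = "nZ + nW" and ?P = "btoa_Pick D"
  define E where "E z = btoa_C D * minv (z \<cdot>\<^sub>m 1\<^sub>m ?n - btoa_A D)" for z
  have R: "minv (z \<cdot>\<^sub>m 1\<^sub>m ?n - btoa_A D) \<in> carrier_mat ?n ?n" if "z \<in> btoa_domain D" for z
    using resolvent(1)[OF A_carrier] that domain_disjoint by blast
  obtain S where S: "finite S" "S \<subseteq> btoa_domain D"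
    and sep: "\<forall>u \<in> carrier_vec ?n.
      (\<forall>w \<in> S. btoa_C D *\<^sub>v (minv (w \<cdot>\<^sub>m 1\<^sub>m ?n - btoa_A D) *\<^sub>v u) = 0\<^sub>v (p + m)) \<longrightarrow> u = 0\<^sub>v ?n"
  proof (rule hautus_separating[OF A_carrier C_carrier domain_infinite domain_disjoint])
    show "v = 0\<^sub>v ?n" if "v \<in> carrier_vec ?n" "btoa_A D *\<^sub>v v = e \<cdot>\<^sub>v v"
      "btoa_C D *\<^sub>v v = 0\<^sub>v (p + m)" for e v
      using that by (rule hautus)
  qed (rule that)
  have "hilbert_space (fun_space (p + m) (btoa_domain D) H) ip \<longleftrightarrow>
      (\<forall>v \<in> carrier_vec ?n. v \<noteq> 0\<^sub>v ?n \<longrightarrow> 0 < Re ((?P *\<^sub>v v) \<bullet>c v))"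
  proof (rule finite_rank_kernel_hilbert_iff[OF _ Pick_carrier minv_invertible[OF Pick_carrier assms(2)] S _ _ assms(3)])
    show "E z \<in> carrier_mat (p + m) ?n" if "z \<in> btoa_domain D" for z
      unfolding E_def by (rule mult_carrier_mat[OF C_carrier R[OF that]])
    show "btoa_kernel D z w = E z * minv ?P * mat_adjoint (E w)"
      if "z \<in> btoa_domain D" "w \<in> btoa_domain D" for z w
      unfolding E_def by (rule kernel_eq[OF assms(2) that])
    fix u assume u: "u \<in> carrier_vec ?n" and z: "\<And>w. w \<in> S \<Longrightarrow> E w *\<^sub>v u = 0\<^sub>v (p + m)"
    show "u = 0\<^sub>v ?n"
    proof (rule sep[rule_format, OF u])
      fix w assume w: "w \<in> S"
      then have "w \<in> btoa_domain D" using S(2) by blast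
      from assoc_mult_mat_vec[OF C_carrier R[OF this] u] z[OF w]
      show "btoa_C D *\<^sub>v (minv (w \<cdot>\<^sub>m 1\<^sub>m ?n - btoa_A D) *\<^sub>v u) = 0\<^sub>v (p + m)"
        by (simp add: E_def)
    qed
  qed
  \<comment> \<open>The Pick matrix is square and Hermitian in any case, so positive definiteness
    amounts to positivity of its form.\<close>
  then show ?thesis
    using Pick_carrier Pick_hermitian by (simp add: positive_definite_def)
qed

end
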